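(* Let $s,t,k\ge 2$ be integers. Let $\mathcal{K}^{\le k}_{s,t}$ denote the family of all graphs that can be obtained from the complete bipartite graph $K_{s,t}$ by replacing each edge $uv$ with a path of length at most $k$ between $u$ and $v$ so that the $st$ replacing paths are internally vertex-disjoint. Then, as $n\to\infty$ (with $s,t,k$ fixed), $$\mathrm{ex}(n,\mathcal{K}^{\le k}_{s,t})=O\left(n^{1+\frac1k-\frac1{sk}}\right).$$
   Context: Graphs are finite and simple. For a family $\mathcal{H}$ of graphs, $\mathrm{ex}(n,\mathcal{H})$ is the largest number of edges in an $n$-vertex graph that does not contain any member of $\mathcal{H}$ as a (not necessarily induced) subgraph. The length of a path is its number of edges; different edges of $K_{s,t}$ may be replaced by paths of different lengths (between $1$ and $k$). *)

theory Defs
  imports Complex_Main "HOL-Library.Landau_Symbols"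
begin

record 'a graph =
  verts :: "'a set"
  edges :: "'a set set"

definition simple_graph :: "'a graph \<Rightarrow> bool" where
  "simple_graph G \<longleftrightarrow> finite (verts G) \<and> (\<forall>e\<in>edges G. e \<subseteq> verts G \<and> card e = 2)"

text \<open>Containment as a not necessarily induced subgraph, up to isomorphism.\<close>

definition contains_graph :: "'a graph \<Rightarrow> 'b graph \<Rightarrow> bool" where
  "contains_graph G H \<longleftrightarrow>
     (\<exists>f. inj_on f (verts H) \<and> f ` verts H \<subseteq> verts G \<and> (\<forall>e\<in>edges H. f ` e \<in> edges G))"

text \<open>Host graphs may be taken on natural numbers, as every finite graph is isomorphic to such a
  graph. The maximum is meaningful as soon as no graph in the family is edgeless, see below.\<close>

definition extremal_number :: "nat \<Rightarrow> 'a graph set \<Rightarrow> nat" where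
  "extremal_number n \<H> =
     Max {card (edges G) | G :: nat graph.
            simple_graph G \<and> card (verts G) = n \<and> (\<forall>H\<in>\<H>. \<not> contains_graph G H)}"

definition complete_bipartite :: "nat \<Rightarrow> nat \<Rightarrow> (nat + nat) graph" where
  "complete_bipartite s t =
     \<lparr>verts = Inl ` {..<s} \<union> Inr ` {..<t},
      edges = {{Inl i, Inr j} | i j. i < s \<and> j < t}\<rparr>"

text \<open>A path is given by the list of its vertices; its length is the number of its edges.\<close>

definition is_path :: "'a list \<Rightarrow> bool" where
  "is_path p \<longleftrightarrow> p \<noteq> [] \<and> distinct p"

definition path_length :: "'a list \<Rightarrow> nat" where
  "path_length p = length p - 1"

definition path_edges :: "'a list \<Rightarrow> 'a set set" where
  "path_edges p = {{p ! i, p ! Suc i} | i. Suc i < length p}"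

definition inner_verts :: "'a list \<Rightarrow> 'a set" where
  "inner_verts p = set p - {hd p, last p}"

text \<open>\<open>H\<close> arises from \<open>F\<close> by replacing every edge \<open>e\<close> with a path \<open>P e\<close> of length at most \<open>k\<close>;
  \<open>f\<close> names the vertices of \<open>F\<close> inside \<open>H\<close>. The inner vertices of each path are new, and
  those of different paths are disjoint. A path has length at least 1 because its endpoints are
  distinct; a path of length 1 leaves the edge in place.\<close>

definition path_replacement :: "nat \<Rightarrow> 'a graph \<Rightarrow> 'b graph \<Rightarrow> bool" where
  "path_replacement k F H \<longleftrightarrow>
     (\<exists>f P. inj_on f (verts F) \<and>
        (\<forall>e\<in>edges F. is_path (P e) \<and> {hd (P e), last (P e)} = f ` e \<and> path_length (P e) \<le> k \<and>
                     inner_verts (P e) \<inter> f ` verts F = {}) \<and>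
        (\<forall>e\<in>edges F. \<forall>e'\<in>edges F. e \<noteq> e' \<longrightarrow> inner_verts (P e) \<inter> inner_verts (P e') = {}) \<and>
        verts H = f ` verts F \<union> (\<Union>e\<in>edges F. set (P e)) \<and>
        edges H = (\<Union>e\<in>edges F. path_edges (P e)))"

definition subdivided_bipartite_family :: "nat \<Rightarrow> nat \<Rightarrow> nat \<Rightarrow> nat graph set" where
  "subdivided_bipartite_family k s t = {H. path_replacement k (complete_bipartite s t) H}"

lemma finite_extremal_set:
  "finite {card (edges G) | G :: nat graph.
     simple_graph G \<and> card (verts G) = n \<and> (\<forall>H\<in>\<H>. \<not> contains_graph G H)}"
proof (rule finite_subset)
  show "{card (edges G) | G :: nat graph.
     simple_graph G \<and> card (verts G) = n \<and> (\<forall>H\<in>\<H>. \<not> contains_graph G H)} \<subseteq> {..2 ^ n}"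
  proof clarsimp
    fix G :: "nat graph"
    assume G: "simple_graph G"
    then have "card (edges G) \<le> card (Pow (verts G))"
      by (intro card_mono) (auto simp: simple_graph_def)
    then show "card (edges G) \<le> 2 ^ card (verts G)"
      using G by (simp add: card_Pow simple_graph_def)
  qed
qed simp

lemma extremal_set_nonempty:
  assumes "\<And>H. H \<in> \<H> \<Longrightarrow> edges H \<noteq> {}"
  shows "{card (edges G) | G :: nat graph.
     simple_graph G \<and> card (verts G) = n \<and> (\<forall>H\<in>\<H>. \<not> contains_graph G H)} \<noteq> {}"
proof -
  let ?G = "\<lparr>verts = {..<n}, edges = {}\<rparr> :: nat graph"
  have "simple_graph ?G \<and> card (verts ?G) = n \<and> (\<forall>H\<in>\<H>. \<not> contains_graph ?G H)"
    using assms by (auto simp: simple_graph_def contains_graph_def)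
  then show ?thesis by blast
qed

lemma subdivided_bipartite_family_edges_nonempty:
  assumes "H \<in> subdivided_bipartite_family k s t" "s > 0" "t > 0"
  shows "edges H \<noteq> {}"
proof -
  let ?F = "complete_bipartite s t" and ?e = "{Inl 0, Inr 0} :: (nat + nat) set"
  have e: "?e \<in> edges ?F" and u: "Inl 0 \<in> verts ?F" "Inr 0 \<in> verts ?F"
    using assms by (auto simp: complete_bipartite_def)
  from assms(1) obtain f P where f: "inj_on f (verts ?F)"
    and P': "\<forall>e\<in>edges ?F. is_path (P e) \<and> {hd (P e), last (P e)} = f ` e \<and> path_length (P e) \<le> k \<and>
                       inner_verts (P e) \<inter> f ` verts ?F = {}"
    and H: "edges H = (\<Union>e\<in>edges ?F. path_edges (P e))"
    unfolding subdivided_bipartite_family_def path_replacement_def mem_Collect_eq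
    by (elim exE conjE) (rule that)
  note P = conjunct1[OF bspec[OF P' e]] conjunct1[OF conjunct2[OF bspec[OF P' e]]]
  have "f (Inl 0) \<noteq> f (Inr 0)"
    using f u by (auto dest: inj_onD)
  then have "hd (P ?e) \<noteq> last (P ?e)"
    using P(2) by (auto simp: doubleton_eq_iff)
  then have "Suc 0 < length (P ?e)"
    using P(1) by (cases "P ?e") (auto simp: is_path_def)
  then have "path_edges (P ?e) \<noteq> {}"
    by (auto simp: path_edges_def)
  then show ?thesis
    using H e by blast
qed

end

theory Submission
  imports Defs "HOL-Library.FuncSet"
begin

text \<open>Pass to a subgraph of minimum degree \<open>d\<close> with \<open>d ^ (s * k)\<close> a large multiple of
  \<open>n ^ (s - 1)\<close>. Call two vertices linked if no bounded set of other vertices meets all paths of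
  length at most \<open>k\<close> between them. Linked pairs cannot form a \<open>K\<^bsub>s,t\<^esub>\<close>, since it would extend
  greedily to a subdivision; by a Kovari-Sos-Turan argument a walk of length \<open>k\<close> of the stationary
  simple random walk is therefore unlikely to contain a linked pair at distance at least 2. Walks
  without such pairs are good; boundedly many of them have given length and end points. Hence \<open>s\<close>
  independent walks from a common stationary start are good and disjoint with probability at
  least 1/2, whereas boundedly many such spiders have given leaves and each has probability at
  most \<open>d powr (- s * k) / n\<close>, so their total probability is \<open>O(n ^ (s - 1) / d ^ (s * k))\<close>.
  Weighting by the random walk makes any regularisation of the graph unnecessary.\<close>

section \<open>Greedy embedding of subdivisions\<close>

text \<open>A pair of vertices may be joined by very many paths, so counting by end points says
  nothing by itself. If a pair is not linked, a blocking set of bounded size meets every short path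
  between its ends, and cutting there reduces to shorter paths; but the two halves again need ends
  that are not linked. Hence a good walk has to avoid linked pairs everywhere and not only at its
  ends. Spiders are treated alike: leaves whose spiders cannot be blocked would carry
  \<open>t\<close> spiders that are disjoint outside the leaves, which is a subdivision with the
  leaves as the side of size \<open>s\<close>. Cutting a leg produces legs of unequal lengths; the
  recursion closes because the family admits every length up to \<open>k\<close>. The constants are
  fixed in the order \<open>eps\<close>, \<open>m\<close>, \<open>d\<close>: \<open>eps\<close> is
  the relative loss allowed when a walk is prolonged by a step, \<open>m\<close> is the number of
  exceptional neighbours conceded in the Kovari-Sos-Turan step, and \<open>d\<close> then exceeds
  certain quantities depending only on \<open>s\<close>, \<open>t\<close>, \<open>k\<close>.\<close>

locale adjacency =
  fixes V :: "'a set" and E :: "'a \<Rightarrow> 'a \<Rightarrow> bool"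
  assumes finite_V: "finite V"
    and sym: "E x y \<Longrightarrow> E y x"
    and irrefl: "\<not> E x x"
    and in_V: "E x y \<Longrightarrow> x \<in> V"
begin

definition walk :: "'a list \<Rightarrow> bool" where
  "walk w \<longleftrightarrow> w \<noteq> [] \<and> set w \<subseteq> V \<and> successively E w"

definition path_between :: "nat \<Rightarrow> 'a \<Rightarrow> 'a \<Rightarrow> 'a list \<Rightarrow> bool" where
  "path_between k x y p \<longleftrightarrow>
     walk p \<and> distinct p \<and> hd p = x \<and> last p = y \<and> length p \<le> Suc k"

definition has_subdivision :: "nat \<Rightarrow> nat \<Rightarrow> nat \<Rightarrow> bool" where
  "has_subdivision s t k \<longleftrightarrow> (\<exists>a b p.
     inj_on a {..<s} \<and> inj_on b {..<t} \<and> a ` {..<s} \<inter> b ` {..<t} = {} \<and>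
     (\<forall>i<s. \<forall>j<t. path_between k (a i) (b j) (p i j) \<and>
        inner_verts (p i j) \<inter> (a ` {..<s} \<union> b ` {..<t}) = {}) \<and>
     (\<forall>i<s. \<forall>j<t. \<forall>i'<s. \<forall>j'<t. (i, j) \<noteq> (i', j') \<longrightarrow>
        inner_verts (p i j) \<inter> inner_verts (p i' j') = {}))"

text \<open>The set \<open>S\<close> must avoid both ends, so adjacent vertices are linked as soon
  as \<open>k\<close> is at least 1, and every vertex of \<open>V\<close> is linked to itself. For
  this reason only pairs that are not consecutive on a walk count below.\<close>

definition linked :: "nat \<Rightarrow> nat \<Rightarrow> 'a \<Rightarrow> 'a \<Rightarrow> bool" where
  "linked k L x y \<longleftrightarrow>
     (\<forall>S. finite S \<and> card S \<le> L \<and> x \<notin> S \<and> y \<notin> S \<longrightarrow> (\<exists>p. path_between k x y p \<and> set p \<inter> S = {}))"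

definition spider :: "nat \<Rightarrow> nat \<Rightarrow> (nat \<Rightarrow> 'a) \<Rightarrow> 'a \<Rightarrow> (nat \<Rightarrow> 'a list) \<Rightarrow> bool" where
  "spider s k v u ws \<longleftrightarrow>
     (\<forall>i<s. path_between k u (v i) (ws i) \<and> u \<noteq> v i) \<and>
     (\<forall>i<s. \<forall>j<s. i \<noteq> j \<longrightarrow> set (ws i) \<inter> set (ws j) = {u})"

lemma walk_rev [simp]: "walk (rev w) \<longleftrightarrow> walk w"
proof -
  have "E y x = E x y" for x y
    using sym by blast
  then show ?thesis
    by (simp add: walk_def)
qed

lemma path_between_ends:
  "path_between k x y p \<Longrightarrow> x \<in> set p \<and> y \<in> set p"
  by (auto simp: path_between_def walk_def)

lemma path_between_rev: "path_between k x y p \<Longrightarrow> path_between k y x (rev p)"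
  by (auto simp: path_between_def hd_rev last_rev)

lemma inner_verts_rev [simp]: "inner_verts (rev p) = inner_verts p"
  by (cases "p = []") (auto simp: inner_verts_def hd_rev last_rev)

lemma finite_inner_verts [simp]: "finite (inner_verts p)"
  by (simp add: inner_verts_def)

lemma card_inner_verts_le: "card (inner_verts p) \<le> length p"
  unfolding inner_verts_def by (meson card_length card_mono Diff_subset finite_set le_trans)

text \<open>The paths are chosen one pair at a time, each avoiding all branch vertices and all inner
  vertices placed before. The budget counts \<open>s + t\<close> branch vertices and at most
  \<open>Suc k\<close> vertices for each of the \<open>s * t\<close> paths.\<close>

lemma linked_bipartite_imp_subdivision:
  assumes a: "inj_on a {..<s}" and b: "inj_on b {..<t}"
    and ab: "a ` {..<s} \<inter> b ` {..<t} = {}"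
    and linked: "\<And>i j. i < s \<Longrightarrow> j < t \<Longrightarrow> linked k L (a i) (b j)"
    and L: "s + t + s * t * Suc k \<le> L"
  shows "has_subdivision s t k"
proof -
  let ?X = "a ` {..<s} \<union> b ` {..<t}"
  define ok where "ok p I \<longleftrightarrow>
     (\<forall>e\<in>I. path_between k (a (fst e)) (b (snd e)) (p e) \<and> inner_verts (p e) \<inter> ?X = {}) \<and>
     (\<forall>e\<in>I. \<forall>e'\<in>I. e \<noteq> e' \<longrightarrow> inner_verts (p e) \<inter> inner_verts (p e') = {})" for p I
  have "\<exists>p. ok p I" if "finite I" "I \<subseteq> {..<s} \<times> {..<t}" for I
    using that
  proof (induction I rule: finite_induct)
    case empty
    then show ?case by (simp add: ok_def)
  next
    case (insert e I)
    then obtain p where p: "ok p I" by auto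
    obtain i j where e: "e = (i, j)" and ij: "i < s" "j < t"
      using insert.prems by auto
    \<comment> \<open>The ends of the new path are taken out because linkedness only concerns sets
      avoiding them; they are not inner vertices of that path anyway.\<close>
    define S where "S = (?X \<union> (\<Union>e\<in>I. inner_verts (p e))) - {a i, b j}"
    have "card I \<le> card ({..<s} \<times> {..<t})"
      using insert.prems by (intro card_mono) auto
    then have "card I \<le> s * t"
      by simp
    have "card (inner_verts (p e)) \<le> Suc k" if "e \<in> I" for e
      using p that card_inner_verts_le[of "p e"] by (fastforce simp: ok_def path_between_def)
    then have "card (\<Union>e\<in>I. inner_verts (p e)) \<le> card I * Suc k"
      using card_UN_le[OF \<open>finite I\<close>, of "\<lambda>e. inner_verts (p e)"]
        sum_bounded_above[of I "\<lambda>e. card (inner_verts (p e))" "Suc k"]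
      by (simp del: mult_Suc_right)
    also have "\<dots> \<le> s * t * Suc k"
      using \<open>card I \<le> s * t\<close> by (intro mult_right_mono) auto
    finally have 1: "card (\<Union>e\<in>I. inner_verts (p e)) \<le> s * t * Suc k" .
    have 2: "card ?X \<le> s + t"
      using card_Un_le[of "a ` {..<s}" "b ` {..<t}"] card_image_le[of "{..<s}" a]
        card_image_le[of "{..<t}" b] by simp
    have fin: "finite (?X \<union> (\<Union>e\<in>I. inner_verts (p e)))"
      using \<open>finite I\<close> by simp
    have "card S \<le> card (?X \<union> (\<Union>e\<in>I. inner_verts (p e)))"
      unfolding S_def using fin by (intro card_mono) auto
    also have "\<dots> \<le> L"
      using card_Un_le[of ?X "\<Union>e\<in>I. inner_verts (p e)"] 1 2 L by linarith
    finally have "card S \<le> L" .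
    moreover have "finite S" "a i \<notin> S" "b j \<notin> S"
      using fin by (auto simp: S_def)
    ultimately obtain r where r: "path_between k (a i) (b j) r" "set r \<inter> S = {}"
      using linked[OF ij] unfolding linked_def by blast
    have inner: "inner_verts r \<subseteq> set r - {a i, b j}"
      using r(1) by (auto simp: inner_verts_def path_between_def)
    have X: "inner_verts r \<inter> ?X = {}" and "\<forall>e\<in>I. inner_verts r \<inter> inner_verts (p e) = {}"
      using r(2) inner unfolding S_def by blast+
    then have "\<forall>e\<in>I. inner_verts r \<inter> inner_verts (p e) = {} \<and> inner_verts (p e) \<inter> inner_verts r = {}"
      by (simp add: Int_commute)
    moreover have "\<forall>e'\<in>I. e' \<noteq> e"
      using insert.hyps by blast
    ultimately have "ok (p(e := r)) (insert e I)"
      using p r(1) X e unfolding ok_def by simp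
    then show ?case by blast
  qed
  from this[OF _ order_refl] obtain p where p: "ok p ({..<s} \<times> {..<t})"
    by auto
  then show ?thesis
    unfolding has_subdivision_def using a b ab
    by (intro exI[of _ a] exI[of _ b] exI[of _ "\<lambda>i j. p (i, j)"]) (auto simp: ok_def)
qed

lemma spider_leaf_notin:
  assumes "spider s k v u ws" "i < s" "j < s" "i \<noteq> j"
  shows "v i \<notin> set (ws j)"
proof
  assume "v i \<in> set (ws j)"
  moreover have "v i \<in> set (ws i)"
    using assms path_between_ends unfolding spider_def by metis
  ultimately have "v i = u"
    using assms by (auto simp: spider_def)
  then show False
    using assms by (auto simp: spider_def)
qed

lemma spider_inj_leaves:
  assumes "spider s k v u ws"
  shows "inj_on v {..<s}"
proof (rule inj_onI, rule ccontr)
  fix i j assume ij: "i \<in> {..<s}" "j \<in> {..<s}" "v i = v j" "i \<noteq> j"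
  then have "v j \<in> set (ws j)"
    using assms path_between_ends unfolding spider_def by (metis lessThan_iff)
  then show False
    using spider_leaf_notin[OF assms, of i j] ij by auto
qed

text \<open>The leaves become the side of size \<open>s\<close>, the centres of \<open>t\<close>
  spiders the other side. Spiders are added one at a time, each avoiding the vertices of the earlier
  ones except the common leaves; together they have at most \<open>t * (s * Suc k)\<close>
  vertices.\<close>

lemma robust_spiders_imp_subdivision:
  assumes robust: "\<And>Z. finite Z \<Longrightarrow> card Z \<le> L \<Longrightarrow> Z \<inter> v ` {..<s} = {} \<Longrightarrow>
      \<exists>u ws. spider s k v u ws \<and> (\<Union>i<s. set (ws i)) \<inter> Z = {}"
    and L: "s * t * Suc k \<le> L" and s: "s \<ge> 1"
  shows "has_subdivision s t k"
proof -
  define X where "X ws = (\<Union>i<s. set (ws i))" for ws :: "nat \<Rightarrow> 'a list"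
  have finX: "finite (X ws)" for ws
    by (simp add: X_def)
  have cardX: "card (X ws) \<le> s * Suc k" if "spider s k v u ws" for u ws
  proof -
    have "card (set (ws i)) \<le> Suc k" if "i \<in> {..<s}" for i
      using \<open>spider s k v u ws\<close> that card_length[of "ws i"]
      by (force simp: spider_def path_between_def)
    then show ?thesis
      unfolding X_def using card_UN_le[of "{..<s}" "\<lambda>i. set (ws i)"]
        sum_bounded_above[of "{..<s}" "\<lambda>i. card (set (ws i))" "Suc k"]
      by (simp del: mult_Suc_right)
  qed
  define ok where "ok n U W \<longleftrightarrow> (\<forall>j<n. spider s k v (U j) (W j)) \<and>
     (\<forall>j<n. \<forall>j'<n. j \<noteq> j' \<longrightarrow> X (W j) \<inter> X (W j') \<subseteq> v ` {..<s})" for n :: nat and U W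
  have "\<exists>U W. ok n U W" if "n \<le> t" for n
    using that
  proof (induction n)
    case 0
    then show ?case by (simp add: ok_def)
  next
    case (Suc n)
    then obtain U W where UW: "ok n U W" by auto
    define Z where "Z = (\<Union>j<n. X (W j)) - v ` {..<s}"
    have "card Z \<le> card (\<Union>j<n. X (W j))"
      unfolding Z_def by (intro card_mono) (auto simp: finX)
    also have "\<dots> \<le> (\<Sum>j<n. card (X (W j)))"
      by (rule card_UN_le) simp
    also have "\<dots> \<le> n * (s * Suc k)"
    proof -
      have "card (X (W j)) \<le> s * Suc k" if "j \<in> {..<n}" for j
        using UW cardX that unfolding ok_def by blast
      then show ?thesis
        using sum_bounded_above[of "{..<n}" "\<lambda>j. card (X (W j))" "s * Suc k"] by simp
    qed
    also have "\<dots> \<le> t * (s * Suc k)"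
      using Suc.prems by (intro mult_right_mono) auto
    also have "\<dots> \<le> L"
      using L by (simp add: mult.assoc mult.left_commute del: mult_Suc_right)
    finally have "card Z \<le> L" .
    moreover have "finite Z" "Z \<inter> v ` {..<s} = {}"
      by (auto simp: Z_def finX)
    ultimately obtain u ws where u: "spider s k v u ws" "X ws \<inter> Z = {}"
      using robust unfolding X_def by meson
    have "\<forall>j<n. X ws \<inter> X (W j) \<subseteq> v ` {..<s}"
      using u(2) unfolding Z_def by blast
    then have new: "\<forall>j<n. X ws \<inter> X (W j) \<subseteq> v ` {..<s} \<and> X (W j) \<inter> X ws \<subseteq> v ` {..<s}"
      by (simp add: Int_commute)
    have "ok (Suc n) (U(n := u)) (W(n := ws))"
      using UW u(1) new unfolding ok_def by (simp add: All_less_Suc)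
    then show ?case by blast
  qed
  then obtain U W where UW: "ok t U W" by blast
  have sp: "spider s k v (U j) (W j)" if "j < t" for j
    using UW that by (simp add: ok_def)
  have dis: "X (W j) \<inter> X (W j') \<subseteq> v ` {..<s}" if "j < t" "j' < t" "j \<noteq> j'" for j j'
    using UW that by (simp add: ok_def)
  have pb: "path_between k (U j) (v i) (W j i)" "U j \<noteq> v i" if "i < s" "j < t" for i j
    using sp that by (auto simp: spider_def)
  have UX: "U j \<in> set (W j i)" if "i < s" "j < t" for i j
    using path_between_ends[OF pb(1)[OF that]] by simp
  have inner: "inner_verts (W j i) = set (W j i) - {U j, v i}" if "i < s" "j < t" for i j
    using pb[OF that] by (auto simp: inner_verts_def path_between_def)
  have nov: "v i' \<notin> inner_verts (W j i)" if "i < s" "j < t" "i' < s" for i i' j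
    using spider_leaf_notin[OF sp[OF that(2)] that(3,1)] that by (cases "i = i'") (auto simp: inner)
  have inX: "set (W j i) \<subseteq> X (W j)" if "i < s" for i j
    using that by (auto simp: X_def)
  \<comment> \<open>The centre of one spider on a leg of another would have to be a common leaf,
    which no centre is.\<close>
  have noU: "U j' \<notin> inner_verts (W j i)" if "i < s" "j < t" "j' < t" for i j j'
  proof (cases "j = j'")
    case False
    show ?thesis
    proof
      assume "U j' \<in> inner_verts (W j i)"
      then have "U j' \<in> X (W j) \<inter> X (W j')"
        using inner[OF that(1,2)] inX[OF that(1), of j] inX[OF that(1), of j'] UX[OF that(1,3)] by blast
      then have "U j' \<in> v ` {..<s}"
        using dis[OF that(2,3) False] by blast
      then show False
        using pb(2)[OF _ that(3)] by auto
    qed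
  qed (use inner[OF that(1,2)] in simp)
  have disj: "inner_verts (W j i) \<inter> inner_verts (W j' i') = {}"
    if "i < s" "j < t" "i' < s" "j' < t" "(i, j) \<noteq> (i', j')" for i i' j j'
  proof (cases "j = j'")
    case True
    then have "set (W j i) \<inter> set (W j' i') = {U j}"
      using sp that by (auto simp: spider_def)
    then show ?thesis
      using inner[OF that(1,2)] inner[OF that(3,4)] True by blast
  next
    case False
    have "inner_verts (W j i) \<subseteq> X (W j)" "inner_verts (W j' i') \<subseteq> X (W j')"
      using inX[OF that(1), of j] inX[OF that(3), of j'] by (auto simp: inner_verts_def)
    then have "inner_verts (W j i) \<inter> inner_verts (W j' i') \<subseteq> v ` {..<s}"
      using dis[OF that(2,4) False] by blast
    moreover have "v ` {..<s} \<inter> inner_verts (W j i) = {}"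
      using nov[OF that(1,2)] by blast
    ultimately show ?thesis
      by blast
  qed
  have injU: "inj_on U {..<t}"
  proof (rule inj_onI, rule ccontr)
    fix j j' assume j: "j \<in> {..<t}" "j' \<in> {..<t}" "U j = U j'" "j \<noteq> j'"
    then have "U j \<in> X (W j) \<inter> X (W j')"
      using UX[of 0 j] UX[of 0 j'] inX[of 0 j] inX[of 0 j'] s by auto
    then have "U j \<in> v ` {..<s}"
      using dis[of j j'] j by blast
    then show False
      using pb(2)[of _ j] j by auto
  qed
  show ?thesis
  proof (cases "t = 0")
    \<comment> \<open>Without centres, injectivity of the leaves still has to come from some
      spider.\<close>
    case True
    have "\<exists>u ws. spider s k v u ws"
      using robust[of "{}"] by auto
    then have "inj_on v {..<s}"
      using spider_inj_leaves by blast
    then show ?thesis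
      unfolding has_subdivision_def using True by (intro exI[of _ v]) auto
  next
    case False
    have "inj_on v {..<s}"
      using spider_inj_leaves[OF sp[of 0]] False by auto
    moreover have "v ` {..<s} \<inter> U ` {..<t} = {}"
      using pb(2) by (auto simp: disjoint_iff) metis
    moreover have "inner_verts (rev (W j i)) \<inter> (v ` {..<s} \<union> U ` {..<t}) = {}"
      if "i < s" "j < t" for i j
      using nov noU that by auto
    ultimately show ?thesis
      unfolding has_subdivision_def using injU pb(1) disj
      by (intro exI[of _ v] exI[of _ U] exI[of _ "\<lambda>i j. rev (W j i)"])
        (simp add: path_between_rev)
  qed
qed

end

section \<open>Good walks and spiders\<close>

text \<open>Recursion on a bound for the total length of the legs. One of \<open>L\<close> blocking
  vertices is either the centre, with at most \<open>B ^ s\<close> choices of legs, or lies on one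
  of \<open>s\<close> legs at one of at most \<open>k\<close> positions; cutting there leaves a
  spider of smaller total length and a walk with at most \<open>B\<close> choices. The start is 0
  because legs have length at least 1.\<close>

primrec spider_bound :: "nat \<Rightarrow> nat \<Rightarrow> nat \<Rightarrow> nat \<Rightarrow> nat \<Rightarrow> nat" where
  "spider_bound L B s k 0 = 0"
| "spider_bound L B s k (Suc n) = L * (B ^ s + s * k * (spider_bound L B s k n * B))"

text \<open>One budget that serves both greedy embeddings above.\<close>

definition blocker_size :: "nat \<Rightarrow> nat \<Rightarrow> nat \<Rightarrow> nat" where
  "blocker_size s t k = s + t + s * t * Suc k"

text \<open>The exponent is rounded up to \<open>k\<close> so that one bound serves all walk lengths
  from 1 to \<open>k\<close>.\<close>

definition path_bound :: "nat \<Rightarrow> nat \<Rightarrow> nat \<Rightarrow> nat" where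
  "path_bound s t k = Suc (blocker_size s t k * k) ^ k"

locale subdivision_free = adjacency +
  fixes s t k :: nat
  assumes s: "s \<ge> 2" and no_subdivision: "\<not> has_subdivision s t k"
begin

abbreviation "L \<equiv> blocker_size s t k"
abbreviation "B \<equiv> path_bound s t k"
abbreviation "lk \<equiv> linked k L"

definition good :: "'a list \<Rightarrow> bool" where
  "good w \<longleftrightarrow> walk w \<and> (\<forall>xs x ys y zs. w = xs @ x # ys @ y # zs \<and> ys \<noteq> [] \<longrightarrow> \<not> lk x y)"

definition good_walks :: "nat \<Rightarrow> 'a \<Rightarrow> 'a \<Rightarrow> 'a list set" where
  "good_walks l x y = {w. good w \<and> length w = Suc l \<and> hd w = x \<and> last w = y}"

text \<open>The centre is not a parameter but read off as \<open>hd (ws 0)\<close>, since spiders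
  with given leaves are counted over all centres at once. Restricting to \<open>extensional\<close>
  functions makes this count finite.\<close>

definition good_spiders :: "(nat \<Rightarrow> 'a) \<Rightarrow> (nat \<Rightarrow> nat) \<Rightarrow> (nat \<Rightarrow> 'a list) set" where
  "good_spiders v l = {ws \<in> extensional {..<s}.
     (\<forall>i<s. ws i \<in> good_walks (l i) (hd (ws 0)) (v i)) \<and>
     (\<forall>i<s. \<forall>j<s. i \<noteq> j \<longrightarrow> set (ws i) \<inter> set (ws j) = {hd (ws 0)})}"

lemma linked_refl: "x \<in> V \<Longrightarrow> lk x x"
  unfolding linked_def
  by (auto intro!: exI[of _ "[x]"] simp: path_between_def walk_def)

lemma linked_sym: "lk x y \<Longrightarrow> lk y x"
  unfolding linked_def by (metis path_between_rev set_rev)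

lemma good_imp_walk: "good w \<Longrightarrow> walk w"
  by (simp add: good_def)

lemma good_not_linked: "good (xs @ x # ys @ y # zs) \<Longrightarrow> ys \<noteq> [] \<Longrightarrow> \<not> lk x y"
  unfolding good_def by blast

lemma goodI:
  "walk w \<Longrightarrow> (\<And>xs x ys y zs. w = xs @ x # ys @ y # zs \<Longrightarrow> ys \<noteq> [] \<Longrightarrow> \<not> lk x y) \<Longrightarrow> good w"
  unfolding good_def by blast

lemma walk_appendD1: "walk (xs @ ys) \<Longrightarrow> xs \<noteq> [] \<Longrightarrow> walk xs"
  and walk_appendD2: "walk (xs @ ys) \<Longrightarrow> ys \<noteq> [] \<Longrightarrow> walk ys"
  by (auto simp: walk_def successively_append_iff)

lemma good_appendD1:
  assumes "good (xs @ ys)" "xs \<noteq> []"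
  shows "good xs"
proof (rule goodI)
  show "walk xs"
    using assms good_imp_walk walk_appendD1 by blast
  fix p x q y r assume "xs = p @ x # q @ y # r" "q \<noteq> []"
  then show "\<not> lk x y"
    using good_not_linked[of p x q y "r @ ys"] assms by simp
qed

lemma good_appendD2:
  assumes "good (xs @ ys)" "ys \<noteq> []"
  shows "good ys"
proof (rule goodI)
  show "walk ys"
    using assms good_imp_walk walk_appendD2 by blast
  fix p x q y r assume "ys = p @ x # q @ y # r" "q \<noteq> []"
  then show "\<not> lk x y"
    using good_not_linked[of "xs @ p" x q y r] assms by simp
qed

lemma good_rev_imp:
  assumes "good w"
  shows "good (rev w)"
proof (rule goodI)
  show "walk (rev w)"
    using assms by (simp add: good_imp_walk)
  fix xs x ys y zs assume *: "rev w = xs @ x # ys @ y # zs" "ys \<noteq> []"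
  then have "w = rev zs @ y # rev ys @ x # rev xs"
    by (metis append.assoc append_Cons append_Nil rev.simps(2) rev_append rev_rev_ident)
  then show "\<not> lk x y"
    using assms good_not_linked[of "rev zs" y "rev ys" x "rev xs"] linked_sym *(2) by auto
qed

lemma good_rev [simp]: "good (rev w) \<longleftrightarrow> good w"
  using good_rev_imp by force

text \<open>A repeated vertex would form a linked pair with itself, unless the two occurrences are
  consecutive, which irreflexivity of \<open>E\<close> excludes. Thus good walks are paths, and
  blocking sets apply to them.\<close>

lemma good_distinct:
  assumes "good w"
  shows "distinct w"
proof (rule ccontr)
  assume "\<not> distinct w"
  then obtain xs y ys zs where w: "w = xs @ [y] @ ys @ [y] @ zs"
    using not_distinct_decomp by blast
  then have "y \<in> V"
    using assms by (auto simp: good_def walk_def)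
  then have "ys = []"
    using assms w linked_refl good_not_linked[of xs y ys y zs] by auto
  then show False
    using assms w irrefl by (auto simp: good_def walk_def successively_append_iff)
qed

section \<open>Counting good walks between two vertices\<close>

lemma good_walks_split:
  assumes "p @ z # q \<in> good_walks l x y"
  shows "p \<noteq> [] \<Longrightarrow> p @ [z] \<in> good_walks (length p) x z"
    and "z # q \<in> good_walks (length q) z y"
  using assms good_appendD1[of "p @ [z]" q] good_appendD2[of p "z # q"]
  by (auto simp: good_walks_def hd_append)

lemma finite_good_walks: "finite (good_walks l x y)"
proof (rule finite_subset)
  show "good_walks l x y \<subseteq> {w. set w \<subseteq> V \<and> length w = Suc l}"
    by (auto simp: good_walks_def good_def walk_def)
qed (use finite_V in \<open>rule finite_lists_length_eq\<close>)

lemma good_walks_path: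
  "w \<in> good_walks l x y \<Longrightarrow> l \<le> k \<Longrightarrow> path_between k x y w"
  by (auto simp: good_walks_def path_between_def good_distinct good_imp_walk)

text \<open>A single good walk of length at least 2 certifies that its ends are not linked, so at
  most \<open>L\<close> vertices block all short paths between them. Every good walk is cut by such
  a vertex into two shorter good walks. Their bounds have exponents \<open>j - 1\<close> and
  \<open>l - j - 1\<close> with sum \<open>l - 2\<close>, and the at most \<open>L * k\<close>
  choices of vertex and position supply one more factor.\<close>

lemma card_good_walks_le:
  assumes "l \<ge> 1" "l \<le> k"
  shows "card (good_walks l x y) \<le> Suc (L * k) ^ (l - 1)"
  using assms
proof (induction l arbitrary: x y rule: less_induct)
  case (less l)
  let ?c = "Suc (L * k)"
  show ?case
  proof (cases "good_walks l x y = {} \<or> l = 1")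
    case True
    have "good_walks 1 x y \<subseteq> {[x, y]}"
      by (auto simp: good_walks_def length_Suc_conv)
    from card_mono[OF _ this] True show ?thesis
      by auto
  next
    case False
    then obtain w where w: "w \<in> good_walks l x y" by blast
    have l: "l \<ge> 2"
      using False less.prems by simp
    obtain ys where "w = x # ys @ [y]" "ys \<noteq> []"
    proof -
      have 1: "w \<noteq> []" "length w = Suc l" "hd w = x" "last w = y"
        using w by (auto simp: good_walks_def)
      then have "length (butlast (tl w)) > 0"
        using l by simp
      then have "butlast (tl w) \<noteq> []" and "tl w \<noteq> []"
        by (metis length_greater_0_conv, metis butlast.simps(1) length_greater_0_conv)
      moreover have "w = x # butlast (tl w) @ [y]"
        using 1 \<open>tl w \<noteq> []\<close> by (metis append_butlast_last_id last_tl list.collapse)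
      ultimately show ?thesis using that by blast
    qed
    then have "\<not> lk x y"
      using w good_not_linked[of "[]" x ys y "[]"] by (simp add: good_walks_def)
    then obtain S where S: "finite S" "card S \<le> L" "x \<notin> S" "y \<notin> S"
      "\<And>p. path_between k x y p \<Longrightarrow> set p \<inter> S \<noteq> {}"
      unfolding linked_def by blast
    define W where "W z j = (\<lambda>(a, b). a @ tl b) ` (good_walks j x z \<times> good_walks (l - j) z y)" for z j
    have "good_walks l x y \<subseteq> (\<Union>z\<in>S. \<Union>j\<in>{1..<l}. W z j)"
    proof
      fix w assume w: "w \<in> good_walks l x y"
      then obtain z where z: "z \<in> S" "z \<in> set w"
        using S(5)[OF good_walks_path] less.prems by blast
      then obtain p q where pq: "w = p @ z # q"
        by (meson split_list)
      have "p \<noteq> []" "q \<noteq> []" and len: "length p + length q = l"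
        using w pq z S(3,4) by (auto simp: good_walks_def)
      moreover have "p @ [z] \<in> good_walks (length p) x z" "z # q \<in> good_walks (l - length p) z y"
        using good_walks_split[of p z q l x y] w pq \<open>p \<noteq> []\<close> len by auto
      then have "w \<in> W z (length p)"
        unfolding W_def using pq by (intro image_eqI[of _ _ "(p @ [z], z # q)"]) auto
      ultimately show "w \<in> (\<Union>z\<in>S. \<Union>j\<in>{1..<l}. W z j)"
        using z by (intro UN_I[of z] UN_I[of "length p"]) (auto simp: Suc_le_eq)
    qed
    then have "card (good_walks l x y) \<le> card (\<Union>z\<in>S. \<Union>j\<in>{1..<l}. W z j)"
      using S(1) by (intro card_mono) (auto simp: W_def finite_good_walks)
    also have "\<dots> \<le> (\<Sum>z\<in>S. card (\<Union>j\<in>{1..<l}. W z j))"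
      using S(1) by (rule card_UN_le)
    also have "\<dots> \<le> (\<Sum>z\<in>S. \<Sum>j\<in>{1..<l}. card (W z j))"
      by (intro sum_mono card_UN_le) simp
    also have "\<dots> \<le> (\<Sum>z\<in>S. \<Sum>j\<in>{1..<l}. ?c ^ (l - 2))"
    proof (intro sum_mono)
      fix z j assume j: "j \<in> {1..<l}"
      have "card (W z j) \<le> card (good_walks j x z) * card (good_walks (l - j) z y)"
        unfolding W_def using card_image_le[of "good_walks j x z \<times> good_walks (l - j) z y"]
        by (simp add: finite_good_walks card_cartesian_product)
      also have "\<dots> \<le> ?c ^ (j - 1) * ?c ^ (l - j - 1)"
        using j less.prems by (intro mult_mono less.IH) auto
      also have "\<dots> = ?c ^ (l - 2)"
        using j by (simp only: power_add[symmetric], intro arg_cong[of _ _ "\<lambda>n. ?c ^ n"]) auto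
      finally show "card (W z j) \<le> ?c ^ (l - 2)" .
    qed
    also have "\<dots> = card S * (l - 1) * ?c ^ (l - 2)"
      by simp
    also have "\<dots> \<le> ?c * ?c ^ (l - 2)"
    proof (intro mult_right_mono)
      have "card S * (l - 1) \<le> L * k"
        using S(2) less.prems by (intro mult_mono) auto
      then show "card S * (l - 1) \<le> ?c" by simp
    qed auto
    also have "\<dots> = ?c ^ (l - 1)"
      using l by (simp only: power_Suc[symmetric]) (intro arg_cong[of _ _ "\<lambda>n. ?c ^ n"], simp)
    finally show ?thesis .
  qed
qed

lemma card_good_walks_le_path_bound:
  assumes "l \<ge> 1" "l \<le> k"
  shows "card (good_walks l x y) \<le> B"
proof -
  have "card (good_walks l x y) \<le> Suc (L * k) ^ (l - 1)"
    using assms by (rule card_good_walks_le)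
  also have "\<dots> \<le> B"
    unfolding path_bound_def using assms by (intro power_increasing) auto
  finally show ?thesis .
qed

section \<open>Counting good spiders with given leaves\<close>

lemma spider_if_good_spider:
  assumes ws: "ws \<in> good_spiders v l" and l: "\<And>i. i < s \<Longrightarrow> 1 \<le> l i \<and> l i \<le> k"
  shows "spider s k v (hd (ws 0)) ws"
  unfolding spider_def
proof (intro conjI allI impI)
  fix i assume i: "i < s"
  then have w: "ws i \<in> good_walks (l i) (hd (ws 0)) (v i)"
    using ws by (auto simp: good_spiders_def)
  then show "path_between k (hd (ws 0)) (v i) (ws i)"
    using l i good_walks_path by blast
  have "distinct (ws i)" "length (ws i) \<ge> 2"
    using w l[OF i] good_distinct by (auto simp: good_walks_def)
  then have "hd (ws i) \<noteq> last (ws i)"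
    by (cases "ws i") auto
  then show "hd (ws 0) \<noteq> v i"
    using w by (auto simp: good_walks_def)
qed (use ws in \<open>simp add: good_spiders_def\<close>)

lemma finite_good_spiders: "finite (good_spiders v l)"
proof (rule finite_subset)
  show "good_spiders v l \<subseteq> PiE {..<s} (\<lambda>i. {w. set w \<subseteq> V \<and> length w = Suc (l i)})"
  proof
    fix ws assume "ws \<in> good_spiders v l"
    then have "ws \<in> extensional {..<s}" "\<forall>i<s. ws i \<in> good_walks (l i) (hd (ws 0)) (v i)"
      by (simp_all add: good_spiders_def)
    then show "ws \<in> PiE {..<s} (\<lambda>i. {w. set w \<subseteq> V \<and> length w = Suc (l i)})"
      by (simp add: PiE_iff good_walks_def good_def walk_def)
  qed
qed (use finite_V in \<open>auto intro!: finite_PiE finite_lists_length_eq\<close>)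

text \<open>All spiders with these leaves meet a bounded set. If a vertex \<open>z\<close> of this set lies inside a
  leg, cutting the leg at \<open>z\<close> gives a spider with shorter legs in which \<open>z\<close> is a leaf.\<close>

lemma card_good_spiders_le:
  assumes "\<And>i. i < s \<Longrightarrow> 1 \<le> l i \<and> l i \<le> k" "sum l {..<s} \<le> n"
  shows "card (good_spiders v l) \<le> spider_bound L B s k n"
  using assms
proof (induction n arbitrary: v l)
  case 0
  then have "l 0 = 0" "1 \<le> l 0"
    using s 0(1)[of 0] by auto
  then show ?case by simp
next
  case (Suc n)
  let ?M = "spider_bound L B s k n"
  \<comment> \<open>Without such a blocking set the leaves would carry a subdivision. Since
    \<open>Z\<close> avoids the leaves, cutting a leg at a vertex of \<open>Z\<close> always leaves
    a remainder of positive length.\<close>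
  obtain Z where Z: "finite Z" "card Z \<le> L" "Z \<inter> v ` {..<s} = {}"
    "\<And>u ws. spider s k v u ws \<Longrightarrow> (\<Union>i<s. set (ws i)) \<inter> Z \<noteq> {}"
    using robust_spiders_imp_subdivision[of L v s k t] no_subdivision s
    by (fastforce simp: blocker_size_def)
  \<comment> \<open>\<open>C z\<close> covers the spiders with centre \<open>z\<close>, dropping
    disjointness of the legs; \<open>W z i j\<close> covers those whose leg \<open>i\<close> is at
    \<open>z\<close> after \<open>j\<close> steps.\<close>
  define C where "C z = PiE {..<s} (\<lambda>i. good_walks (l i) z (v i))" for z
  define W where "W z i j = (\<lambda>(ws, q). ws(i := ws i @ tl q)) `
     (good_spiders (v(i := z)) (l(i := j)) \<times> good_walks (l i - j) z (v i))" for z i j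
  have "good_spiders v l \<subseteq> (\<Union>z\<in>Z. C z \<union> (\<Union>i<s. \<Union>j\<in>{1..<l i}. W z i j))"
  proof
    fix ws assume ws: "ws \<in> good_spiders v l"
    obtain z i where z: "z \<in> Z" "i < s" "z \<in> set (ws i)"
      using Z(4)[OF spider_if_good_spider[OF ws Suc.prems(1)]] by auto
    have gw: "ws i \<in> good_walks (l i) (hd (ws 0)) (v i)" if "i < s" for i
      using ws that by (auto simp: good_spiders_def)
    have hd: "hd (ws i) = hd (ws 0)" if "i < s" for i
      using gw[OF that] by (simp add: good_walks_def)
    show "ws \<in> (\<Union>z\<in>Z. C z \<union> (\<Union>i<s. \<Union>j\<in>{1..<l i}. W z i j))"
    proof (cases "z = hd (ws 0)")
      case True
      then have "ws \<in> C z"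
        using ws by (auto simp: C_def good_spiders_def PiE_def)
      then show ?thesis
        using z by blast
    next
      case False
      obtain p q where pq: "ws i = p @ z # q"
        using z by (meson split_list)
      have p: "p \<noteq> []"
        using False hd[OF z(2)] pq by auto
      have q: "q \<noteq> []"
        using gw[OF z(2)] z Z(3) pq by (auto simp: good_walks_def)
      have len: "length p + length q = l i"
        using gw[OF z(2)] pq by (auto simp: good_walks_def)
      have 1: "p @ [z] \<in> good_walks (length p) (hd (ws 0)) z"
        and 2: "z # q \<in> good_walks (l i - length p) z (v i)"
        using good_walks_split[of p z q "l i" "hd (ws 0)" "v i"] gw[OF z(2)] p pq
        by (auto simp flip: len)
      define ws' where "ws' = ws(i := p @ [z])"
      have hd': "hd (ws' 0) = hd (ws 0)"
        using pq p by (auto simp: ws'_def)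
      have disj: "set (ws i) \<inter> set (ws j) = {hd (ws 0)}" if "i < s" "j < s" "i \<noteq> j" for i j
        using ws that by (auto simp: good_spiders_def)
      have in_ws: "hd (ws 0) \<in> set (ws j)" if "j < s" for j
        using disj[of j 0] disj[of j 1] that s by (cases "j = 0") auto
      have sub: "set (ws' j) \<subseteq> set (ws j) \<and> hd (ws 0) \<in> set (ws' j)" if "j < s" for j
        using in_ws[OF that] hd[OF z(2)] hd_in_set[OF p] p pq by (auto simp: ws'_def)
      have "set (ws' i') \<inter> set (ws' j') = {hd (ws 0)}" if "i' < s" "j' < s" "i' \<noteq> j'" for i' j'
        using disj[OF that] sub[OF that(1)] sub[OF that(2)] by blast
      moreover have "ws' \<in> extensional {..<s}"
        using ws z by (auto simp: ws'_def good_spiders_def extensional_def)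
      moreover have "ws' j \<in> good_walks ((l(i := length p)) j) (hd (ws 0)) ((v(i := z)) j)" if "j < s" for j
        using 1 gw[OF that] by (simp add: ws'_def)
      ultimately have "ws' \<in> good_spiders (v(i := z)) (l(i := length p))"
        unfolding good_spiders_def hd' mem_Collect_eq by blast
      moreover have "ws = ws'(i := ws' i @ tl (z # q))"
        using pq by (auto simp: ws'_def fun_eq_iff)
      ultimately have "ws \<in> W z i (length p)"
        unfolding W_def using 2 by (intro image_eqI[of _ _ "(ws', z # q)"]) auto
      moreover have "length p > 0" "length q > 0"
        using p q by auto
      then have "length p \<in> {1..<l i}"
        unfolding atLeastLessThan_iff using len by linarith
      ultimately have "ws \<in> (\<Union>i<s. \<Union>j\<in>{1..<l i}. W z i j)"
        using z(2) by (intro UN_I[of i] UN_I[of "length p"]) auto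
      then show ?thesis
        using z(1) by blast
    qed
  qed
  then have "card (good_spiders v l) \<le> card (\<Union>z\<in>Z. C z \<union> (\<Union>i<s. \<Union>j\<in>{1..<l i}. W z i j))"
    using Z(1) by (intro card_mono)
      (auto simp: W_def C_def finite_good_walks finite_good_spiders intro!: finite_PiE)
  also have "\<dots> \<le> (\<Sum>z\<in>Z. card (C z \<union> (\<Union>i<s. \<Union>j\<in>{1..<l i}. W z i j)))"
    using Z(1) by (rule card_UN_le)
  also have "\<dots> \<le> (\<Sum>z\<in>Z. B ^ s + s * k * (?M * B))"
  proof (intro sum_mono)
    fix z
    have "card (C z) = (\<Prod>i<s. card (good_walks (l i) z (v i)))"
      unfolding C_def by (simp add: card_PiE)
    also have "\<dots> \<le> (\<Prod>i<s. B)"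
      using Suc.prems(1) by (intro prod_mono) (auto intro!: card_good_walks_le_path_bound)
    finally have 1: "card (C z) \<le> B ^ s" by simp
    have 2: "card (W z i j) \<le> ?M * B" if ij: "i < s" "j \<in> {1..<l i}" for i j
    proof -
      have "card (W z i j) \<le> card (good_spiders (v(i := z)) (l(i := j)) \<times> good_walks (l i - j) z (v i))"
        unfolding W_def by (intro card_image_le) (simp add: finite_good_spiders finite_good_walks)
      also have "\<dots> = card (good_spiders (v(i := z)) (l(i := j))) * card (good_walks (l i - j) z (v i))"
        by (rule card_cartesian_product)
      also have "\<dots> \<le> ?M * B"
      proof (intro mult_mono Suc.IH card_good_walks_le_path_bound)
        \<comment> \<open>Position \<open>j\<close> is strictly inside leg \<open>i\<close>, so
          cutting lowers the total length by at least 1.\<close>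
        have "sum (l(i := j)) {..<s} < sum l {..<s}"
          using ij by (intro sum_strict_mono_ex1) (auto intro: less_imp_le)
        then show "sum (l(i := j)) {..<s} \<le> n"
          using Suc.prems(2) by simp
        show "l i - j \<le> k"
          using Suc.prems(1)[OF ij(1)] by linarith
        fix i' assume "i' < s"
        then show "1 \<le> (l(i := j)) i' \<and> (l(i := j)) i' \<le> k"
          using Suc.prems(1)[of i'] Suc.prems(1)[OF ij(1)] ij(2) by (cases "i' = i") auto
      qed (use ij in auto)
      finally show ?thesis .
    qed
    have "card (\<Union>i<s. \<Union>j\<in>{1..<l i}. W z i j) \<le> (\<Sum>i<s. card (\<Union>j\<in>{1..<l i}. W z i j))"
      by (rule card_UN_le) simp
    also have "\<dots> \<le> (\<Sum>i<s. \<Sum>j\<in>{1..<l i}. card (W z i j))"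
      by (intro sum_mono card_UN_le) simp
    also have "\<dots> \<le> (\<Sum>i<s. \<Sum>j\<in>{1..<l i}. ?M * B)"
      using 2 by (intro sum_mono) auto
    also have "\<dots> \<le> (\<Sum>i<s. k * (?M * B))"
    proof (rule sum_mono)
      fix i assume "i \<in> {..<s}"
      then have "l i - 1 \<le> k"
        using Suc.prems(1)[of i] by (meson diff_le_self le_trans lessThan_iff)
      then show "(\<Sum>j\<in>{1..<l i}. ?M * B) \<le> k * (?M * B)"
        using mult_right_mono[of "l i - 1" k "?M * B"] by simp
    qed
    finally have "card (\<Union>i<s. \<Union>j\<in>{1..<l i}. W z i j) \<le> s * k * (?M * B)"
      by (simp add: mult.assoc)
    then show "card (C z \<union> (\<Union>i<s. \<Union>j\<in>{1..<l i}. W z i j)) \<le> B ^ s + s * k * (?M * B)"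
      using 1 card_Un_le[of "C z" "\<Union>i<s. \<Union>j\<in>{1..<l i}. W z i j"] by linarith
  qed
  also have "\<dots> \<le> spider_bound L B s k (Suc n)"
    using Z(2) by simp
  finally show ?case .
qed

end

section \<open>Linked pairs on random walks\<close>

text \<open>A weighted Kovari-Sos-Turan bound: if \<open>m\<close> elements of \<open>A\<close> had weighted degree above \<open>\<delta>\<close>, then
  too much weight would lie on points related to at least \<open>s\<close> of them.\<close>

lemma weighted_bipartite_bound:
  fixes q :: "'b \<Rightarrow> real" and e :: "'b \<Rightarrow> 'a"
  assumes I: "finite I" "\<And>v. v \<in> I \<Longrightarrow> q v \<ge> 0" "sum q I \<le> 1"
    and fibre: "\<And>z. sum q {v \<in> I. e v = z} \<le> \<beta>"
    and A: "finite A"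
    and free: "\<And>S T. S \<subseteq> A \<Longrightarrow> card S = s \<Longrightarrow> finite T \<Longrightarrow> card T = t \<Longrightarrow> S \<inter> T = {} \<Longrightarrow>
       \<exists>x\<in>S. \<exists>y\<in>T. \<not> R x y"
    and m: "m > 0" "real s + \<beta> * real m * (real m + 2 ^ m * real t) \<le> real m * \<delta>"
  shows "(\<Sum>x\<in>A. sum q {v \<in> I. R x (e v)}) \<le> real m + real (card A) * \<delta>"
proof -
  define g where "g x = sum q {v \<in> I. R x (e v)}" for x
  have "\<beta> \<ge> 0"
    using fibre[of undefined] I(2) sum_nonneg[of "{v \<in> I. e v = undefined}" q] by force
  have \<delta>: "\<delta> \<ge> 0"
  proof -
    have "0 \<le> real s + \<beta> * real m * (real m + 2 ^ m * real t)"
      using \<open>\<beta> \<ge> 0\<close> by (intro add_nonneg_nonneg mult_nonneg_nonneg) auto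
    then have "0 \<le> real m * \<delta>"
      using m(2) by linarith
    then show ?thesis
      using m(1) by (simp add: zero_le_mult_iff)
  qed
  have g_le_1: "g x \<le> 1" for x
    using sum_mono2[of I "{v \<in> I. R x (e v)}" q] I by (force simp: g_def)
  define A0 where "A0 = {x \<in> A. g x > \<delta>}"
  have A0: "finite A0" "A0 \<subseteq> A"
    using A by (auto simp: A0_def)
  have "card A0 < m"
  proof (rule ccontr)
    assume "\<not> card A0 < m"
    then obtain A' where A': "A' \<subseteq> A0" "card A' = m"
      using obtain_subset_with_card_n[of m A0] by auto
    then have finA': "finite A'"
      using A0 finite_subset by blast
    \<comment> \<open>\<open>Y\<close> consists of \<open>A'\<close> and the values of
      \<open>e\<close> that are related to all of some \<open>s\<close> elements of
      \<open>A'\<close>, so values outside \<open>Y\<close> are related to at most \<open>s\<close>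
      of them. \<open>A'\<close> is set aside because \<open>free\<close> only concerns disjoint
      sets.\<close>
    define c where "c y = card {x \<in> A'. R x y}" for y
    define common where "common S = {y \<in> e ` I. y \<notin> A' \<and> (\<forall>x\<in>S. R x y)}" for S
    define Y where "Y = A' \<union> (\<Union>S\<in>{S. S \<subseteq> A' \<and> card S = s}. common S)"
    have fin_common: "finite (common S)" for S
      using I by (simp add: common_def)
    have common: "card (common S) \<le> t" if "S \<subseteq> A'" "card S = s" for S
    proof (rule ccontr)
      assume "\<not> card (common S) \<le> t"
      then obtain T where T: "T \<subseteq> common S" "card T = t" "finite T"
        using obtain_subset_with_card_n[of t "common S"] by auto
      moreover have "S \<inter> T = {}" "S \<subseteq> A"
        using T(1) that A' A0 by (auto simp: common_def)
      ultimately show False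
        using free[of S T] that by (auto simp: common_def)
    qed
    have fin: "finite {S. S \<subseteq> A' \<and> card S = s}"
      using finA' by simp
    have "card (\<Union>S\<in>{S. S \<subseteq> A' \<and> card S = s}. common S) \<le> (\<Sum>S\<in>{S. S \<subseteq> A' \<and> card S = s}. card (common S))"
      using fin by (rule card_UN_le)
    also have "\<dots> \<le> (\<Sum>S\<in>{S. S \<subseteq> A' \<and> card S = s}. t)"
      using common by (intro sum_mono) auto
    also have "\<dots> \<le> 2 ^ m * t"
    proof -
      have "card {S. S \<subseteq> A' \<and> card S = s} \<le> card (Pow A')"
        using finA' by (intro card_mono) auto
      then show ?thesis
        using A'(2) finA' by (simp add: card_Pow)
    qed
    finally have "card Y \<le> m + 2 ^ m * t"
      unfolding Y_def using card_Un_le[of A'] A'(2) by (metis (no_types, lifting) add_left_mono le_trans)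
    then have Y: "real (card Y) \<le> real m + 2 ^ m * real t"
      using of_nat_le_iff[where ?'a = real, of "card Y" "m + 2 ^ m * t"] by simp
    have finY: "finite Y"
      unfolding Y_def using finA' fin fin_common by blast
    have c: "real (c (e v)) \<le> real s + (if e v \<in> Y then real m else 0)" if "v \<in> I" for v
    proof (cases "e v \<in> Y")
      case True
      have "c (e v) \<le> m"
        unfolding c_def using A'(2) finA' by (metis (no_types, lifting) card_mono mem_Collect_eq subsetI)
      then show ?thesis
        using True by simp
    next
      case False
      have "c (e v) \<le> s"
      proof (rule ccontr)
        assume "\<not> c (e v) \<le> s"
        then obtain S where S: "S \<subseteq> {x \<in> A'. R x (e v)}" "card S = s"
          unfolding c_def using obtain_subset_with_card_n[of s "{x \<in> A'. R x (e v)}"] by auto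
        then have "S \<subseteq> A'" "e v \<in> common S"
          using False that by (auto simp: common_def Y_def)
        then show False
          using False S(2) by (auto simp: Y_def)
      qed
      then show ?thesis
        using False by simp
    qed
    \<comment> \<open>Double counting of the weight of related pairs: values outside
      \<open>Y\<close> contribute at most \<open>s\<close> in all, whereas \<open>Y\<close> has few
      points, each of weight at most \<open>\<beta>\<close> and related to at most \<open>m\<close>
      elements.\<close>
    have "real m * \<delta> = (\<Sum>x\<in>A'. \<delta>)"
      using A'(2) by simp
    also have "\<dots> < (\<Sum>x\<in>A'. g x)"
      using A' m(1) finA' by (intro sum_strict_mono) (auto simp: A0_def)
    also have "\<dots> = (\<Sum>x\<in>A'. \<Sum>v\<in>I. if R x (e v) then q v else 0)"
      unfolding g_def using I(1) by (simp add: sum.inter_filter)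
    also have "\<dots> = (\<Sum>v\<in>I. \<Sum>x\<in>A'. if R x (e v) then q v else 0)"
      by (rule sum.swap)
    also have "\<dots> = (\<Sum>v\<in>I. real (c (e v)) * q v)"
      unfolding c_def using finA' by (simp add: sum.inter_filter[symmetric])
    also have "\<dots> \<le> (\<Sum>v\<in>I. (real s + (if e v \<in> Y then real m else 0)) * q v)"
      using c I(2) by (intro sum_mono mult_right_mono) auto
    also have "\<dots> = real s * sum q I + real m * (\<Sum>v\<in>I. if e v \<in> Y then q v else 0)"
      by (simp add: distrib_right sum.distrib sum_distrib_left if_distrib[of "\<lambda>x. x * _"]
          if_distrib[of "\<lambda>x. _ * x"] cong: if_cong)
    also have "(\<Sum>v\<in>I. if e v \<in> Y then q v else 0) = (\<Sum>y\<in>Y. sum q {v \<in> I. e v = y})"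
    proof -
      have "(\<Sum>y\<in>Y. sum q {v \<in> {v \<in> I. e v \<in> Y}. e v = y}) = sum q {v \<in> I. e v \<in> Y}"
        using I(1) finY by (intro sum.group) auto
      moreover have "{v \<in> {v \<in> I. e v \<in> Y}. e v = y} = {v \<in> I. e v = y}" if "y \<in> Y" for y
        using that by auto
      then have "(\<Sum>y\<in>Y. sum q {v \<in> {v \<in> I. e v \<in> Y}. e v = y}) = (\<Sum>y\<in>Y. sum q {v \<in> I. e v = y})"
        by (intro sum.cong refl arg_cong[of _ _ "sum q"])
      ultimately show ?thesis
        using I(1) by (simp add: sum.inter_filter)
    qed
    also have "\<dots> \<le> real (card Y) * \<beta>"
      using fibre by (rule sum_bounded_above)
    also have "\<dots> \<le> (real m + 2 ^ m * real t) * \<beta>"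
      using Y \<open>\<beta> \<ge> 0\<close> by (rule mult_right_mono)
    also have "real s * sum q I \<le> real s"
      using I(3) by (simp add: mult_left_le)
    finally have "real m * \<delta> < real s + real m * ((real m + 2 ^ m * real t) * \<beta>)"
      by (auto simp: mult_left_mono)
    then show False
      using m(2) by (simp add: mult_ac)
  qed
  \<comment> \<open>The exceptional elements, fewer than \<open>m\<close>, exceed
    \<open>\<delta>\<close> by at most 1 each.\<close>
  have "(\<Sum>x\<in>A. g x) \<le> (\<Sum>x\<in>A. (if x \<in> A0 then 1 else 0) + \<delta>)"
  proof (rule sum_mono)
    fix x assume "x \<in> A"
    then show "g x \<le> (if x \<in> A0 then 1 else 0) + \<delta>"
      using g_le_1[of x] \<delta> by (auto simp: A0_def)
  qed
  also have "\<dots> = real (card A0) + real (card A) * \<delta>"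
  proof -
    have "{x \<in> A. x \<in> A0} = A0"
      using A0 by blast
    then show ?thesis
      using A sum.inter_filter[of A "\<lambda>_. 1::real" "\<lambda>x. x \<in> A0"] by (simp add: sum.distrib)
  qed
  also have "\<dots> \<le> real m + real (card A) * \<delta>"
    using \<open>card A0 < m\<close> by simp
  finally show ?thesis
    by (simp add: g_def)
qed

text \<open>The purpose of the constants: \<open>m_ge\<close> and the first part of
  \<open>d_ge\<close> make the bipartite bound applicable with \<open>\<delta>\<close> equal to
  \<open>eps / 2\<close>; the second part of \<open>d_ge\<close> absorbs the \<open>m\<close>
  exceptional neighbours into another \<open>eps / 2\<close>; \<open>eps_le\<close> and
  \<open>d_ge'\<close> limit to a quarter each the losses of \<open>s\<close> legs through walks
  that are not good and through collisions of legs.\<close>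

locale large_min_degree = subdivision_free +
  fixes m :: nat and eps d :: real
  assumes min_degree: "x \<in> V \<Longrightarrow> d \<le> real (card {y. E x y})"
    and d_ge_1: "d \<ge> 1" and eps: "eps > 0" and m: "m > 0" and k: "k \<ge> 1"
    and m_ge: "real s \<le> real m * eps / 4"
    and d_ge: "real B * (real m + 2 ^ m * real t) \<le> eps / 4 * d" "real m \<le> eps / 2 * d"
    and eps_le: "real s * 2 ^ k * eps \<le> 1 / 4"
    and d_ge': "real s * (real (s * Suc k * k) * real B) \<le> d / 4"
begin

section \<open>Path weights of the simple random walk\<close>

definition nb :: "'a \<Rightarrow> 'a set" where
  "nb x = {y. E x y}"

definition deg :: "'a \<Rightarrow> real" where
  "deg x = real (card (nb x))"

text \<open>The probability that the simple random walk started at the first vertex of \<open>w\<close> follows \<open>w\<close>;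
  under the stationary distribution \<open>deg x / (\<Sum>x\<in>V. deg x)\<close> the probability of \<open>w\<close> is then
  proportional to \<open>prob (tl w)\<close>.\<close>

definition prob :: "'a list \<Rightarrow> real" where
  "prob w = (\<Prod>x\<leftarrow>butlast w. 1 / deg x)"

definition walks_from :: "nat \<Rightarrow> 'a \<Rightarrow> 'a list set" where
  "walks_from l x = {w. walk w \<and> length w = Suc l \<and> hd w = x}"

definition walks :: "nat \<Rightarrow> 'a list set" where
  "walks l = {w. walk w \<and> length w = Suc l}"

definition total :: real where
  "total = (\<Sum>x\<in>V. deg x)"

lemma finite_nb [simp]: "finite (nb x)"
proof (rule finite_subset)
  show "nb x \<subseteq> V"
    using in_V sym by (auto simp: nb_def)
qed (fact finite_V)

lemma deg_ge: "x \<in> V \<Longrightarrow> d \<le> deg x"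
  using min_degree by (simp add: deg_def nb_def)

lemma deg_pos: "x \<in> V \<Longrightarrow> deg x > 0"
  using deg_ge d_ge_1 by fastforce

lemma deg_nonneg: "deg x \<ge> 0"
  by (simp add: deg_def)

lemma finite_walks [simp]: "finite (walks l)"
proof (rule finite_subset)
  show "walks l \<subseteq> {w. set w \<subseteq> V \<and> length w = Suc l}"
    by (auto simp: walks_def walk_def)
qed (use finite_V in \<open>rule finite_lists_length_eq\<close>)

lemma walks_from_subset: "walks_from l x \<subseteq> walks l"
  by (auto simp: walks_from_def walks_def)

lemma finite_walks_from [simp]: "finite (walks_from l x)"
  using finite_subset[OF walks_from_subset] by simp

lemma prob_Cons: "w \<noteq> [] \<Longrightarrow> prob (x # w) = prob w / deg x"
  by (simp add: prob_def)

lemma prob_singleton [simp]: "prob [x] = 1"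
  by (simp add: prob_def)

lemma prob_nonneg: "prob w \<ge> 0"
  unfolding prob_def by (rule prod_list_nonneg) (auto simp: deg_def)

lemma prob_append: "p \<noteq> [] \<Longrightarrow> prob (p @ r) = prob p * prob (last p # r)"
proof (induction p)
  case (Cons x p)
  then show ?case
    by (cases "p = []"; cases "r = []") (auto simp: prob_Cons)
qed simp

lemma walk_Cons: "v \<noteq> [] \<Longrightarrow> walk (x # v) \<longleftrightarrow> walk v \<and> E (hd v) x"
  using in_V sym by (cases v) (auto simp: walk_def)

text \<open>Every step after the first contributes at most \<open>1 / d\<close>. The factor of the
  starting vertex is kept exact because it later cancels against its stationary weight.\<close>

lemma prob_le:
  assumes "walk w" "length w = Suc (Suc l)"
  shows "prob w \<le> 1 / deg (hd w) * (1 / d) ^ l"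
  using assms
proof (induction l arbitrary: w)
  case 0
  then obtain x y where "w = [x, y]"
    by (auto simp: length_Suc_conv)
  then show ?case
    by (simp add: prob_Cons)
next
  case (Suc l)
  then obtain x v where w: "w = x # v" "length v = Suc (Suc l)"
    by (auto simp: length_Suc_conv)
  then have v: "v \<noteq> []" by auto
  then have "walk v"
    using Suc.prems(1) walk_Cons w(1) by blast
  have "hd v \<in> V"
    using \<open>walk v\<close> v by (auto simp: walk_def)
  have "prob v \<le> 1 / deg (hd v) * (1 / d) ^ l"
    using Suc.IH \<open>walk v\<close> w(2) by blast
  also have "\<dots> \<le> 1 / d * (1 / d) ^ l"
    using deg_ge[OF \<open>hd v \<in> V\<close>] d_ge_1 by (intro mult_right_mono divide_left_mono) auto
  finally have "prob v * (1 / deg x) \<le> (1 / d) ^ Suc l * (1 / deg x)"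
    using deg_nonneg by (intro mult_right_mono) auto
  then show ?case
    using v w(1) by (simp add: prob_Cons mult_ac)
qed

lemma prob_le_inverse:
  assumes "walk w" "length w \<ge> 2"
  shows "prob w \<le> 1 / d"
proof -
  obtain l where l: "length w = Suc (Suc l)"
    using assms(2) by (auto simp: numeral_2_eq_2 le_iff_add)
  have "hd w \<in> V"
    using assms by (auto simp: walk_def)
  have "prob w \<le> 1 / deg (hd w) * (1 / d) ^ l"
    using assms(1) l by (rule prob_le)
  also have "\<dots> \<le> 1 / d * 1"
    using deg_ge[OF \<open>hd w \<in> V\<close>] d_ge_1
    by (intro mult_mono divide_left_mono power_le_one) auto
  finally show ?thesis by simp
qed

lemma sum_walks_from_Suc:
  assumes "x \<in> V"
  shows "sum f (walks_from (Suc l) x) = (\<Sum>y\<in>nb x. \<Sum>v\<in>walks_from l y. f (x # v))"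
proof -
  have "bij_betw (\<lambda>(y, v). x # v) (Sigma (nb x) (walks_from l)) (walks_from (Suc l) x)"
  proof (rule bij_betwI[where g = "\<lambda>w. (hd (tl w), tl w)"])
    show "(\<lambda>(y, v). x # v) \<in> Sigma (nb x) (walks_from l) \<rightarrow> walks_from (Suc l) x"
    proof clarsimp
      fix y v assume "y \<in> nb x" "v \<in> walks_from l y"
      moreover from this have "v \<noteq> []" by (auto simp: walks_from_def)
      ultimately show "x # v \<in> walks_from (Suc l) x"
        by (simp add: walks_from_def nb_def walk_Cons sym)
    qed
    show "(\<lambda>w. (hd (tl w), tl w)) \<in> walks_from (Suc l) x \<rightarrow> Sigma (nb x) (walks_from l)"
    proof
      fix w assume w: "w \<in> walks_from (Suc l) x"
      then obtain v where v: "w = x # v" "length v = Suc l"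
        by (cases w) (auto simp: walks_from_def)
      moreover from this have "v \<noteq> []" by auto
      ultimately show "(hd (tl w), tl w) \<in> Sigma (nb x) (walks_from l)"
        using w by (simp add: walks_from_def nb_def walk_Cons sym)
    qed
  qed (auto simp: walks_from_def neq_Nil_conv length_Suc_conv)
  then show ?thesis
    by (simp add: sum.Sigma sum.reindex_bij_betw[symmetric] split_def)
qed

lemma sum_prob_walks_from: "x \<in> V \<Longrightarrow> sum prob (walks_from l x) = 1"
proof (induction l arbitrary: x)
  case 0
  then have "walks_from 0 x = {[x]}"
    by (auto simp: walks_from_def length_Suc_conv walk_def)
  then show ?case by simp
next
  case (Suc l)
  have "sum prob (walks_from (Suc l) x) = (\<Sum>y\<in>nb x. \<Sum>v\<in>walks_from l y. prob v / deg x)"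
    unfolding sum_walks_from_Suc[OF Suc.prems]
    by (intro sum.cong refl prob_Cons) (auto simp: walks_from_def)
  also have "\<dots> = (\<Sum>y\<in>nb x. 1 / deg x)"
  proof (rule sum.cong[OF refl])
    fix y assume "y \<in> nb x"
    then have "y \<in> V"
      using in_V sym by (auto simp: nb_def)
    then show "(\<Sum>v\<in>walks_from l y. prob v / deg x) = 1 / deg x"
      using Suc.IH by (simp add: sum_divide_distrib[symmetric])
  qed
  also have "\<dots> = deg x * (1 / deg x)"
    by (simp add: deg_def)
  also have "\<dots> = 1"
    using deg_pos[OF Suc.prems] by simp
  finally show ?case .
qed

lemma sum_walks: "sum f (walks l) = (\<Sum>y\<in>V. sum f (walks_from l y))"
proof -
  have "(\<Sum>y\<in>V. sum f {w \<in> walks l. hd w = y}) = sum f (walks l)"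
    using finite_V by (intro sum.group) (simp, simp, auto simp: walks_def walk_def)
  moreover have "{w \<in> walks l. hd w = y} = walks_from l y" for y
    by (auto simp: walks_def walks_from_def)
  ultimately show ?thesis by simp
qed

lemma sum_walks_Suc:
  "sum f (walks (Suc l)) = (\<Sum>v\<in>walks l. \<Sum>x\<in>nb (hd v). f (x # v))"
proof -
  have "bij_betw (\<lambda>(v, x). x # v) (Sigma (walks l) (\<lambda>v. nb (hd v))) (walks (Suc l))"
  proof (rule bij_betwI[where g = "\<lambda>w. (tl w, hd w)"])
    show "(\<lambda>(v, x). x # v) \<in> Sigma (walks l) (\<lambda>v. nb (hd v)) \<rightarrow> walks (Suc l)"
    proof clarsimp
      fix v x assume "v \<in> walks l" "x \<in> nb (hd v)"
      moreover from this have "v \<noteq> []" by (auto simp: walks_def)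
      ultimately show "x # v \<in> walks (Suc l)"
        by (simp add: walks_def nb_def walk_Cons)
    qed
    show "(\<lambda>w. (tl w, hd w)) \<in> walks (Suc l) \<rightarrow> Sigma (walks l) (\<lambda>v. nb (hd v))"
    proof
      fix w assume w: "w \<in> walks (Suc l)"
      then obtain x v where v: "w = x # v" "length v = Suc l"
        by (cases w) (auto simp: walks_def)
      moreover from this have "v \<noteq> []" by auto
      ultimately show "(tl w, hd w) \<in> Sigma (walks l) (\<lambda>v. nb (hd v))"
        using w by (simp add: walks_def nb_def walk_Cons)
    qed
  qed (auto simp: walks_def length_Suc_conv)
  then show ?thesis
    by (simp add: sum.Sigma sum.reindex_bij_betw[symmetric] split_def)
qed

lemma prob_tl:
  assumes "walk w" "length w \<ge> 2"
  shows "prob (tl w) = deg (hd w) * prob w"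
proof -
  obtain x v where w: "w = x # v"
    using assms(2) by (cases w) auto
  then have "v \<noteq> []"
    using assms(2) by auto
  moreover have "x \<in> V"
    using assms w by (auto simp: walk_def)
  ultimately show ?thesis
    using w deg_pos[of x] by (simp add: prob_Cons)
qed

text \<open>\<open>prob (tl w)\<close> multiplies the inverse degrees at the inner positions of
  \<open>w\<close> only, hence it does not see the direction. This is the reversibility of the
  random walk.\<close>

lemma prob_tl_rev: "prob (tl (rev w)) = prob (tl w)"
proof -
  have "butlast (tl (rev w)) = rev (butlast (tl w))"
    by (cases w; cases "tl w" rule: rev_cases) auto
  moreover have "prod_list (rev xs) = prod_list xs" for xs :: "real list"
    by (induction xs) auto
  ultimately show ?thesis
    unfolding prob_def by (simp only: rev_map[symmetric])
qed

section \<open>Walks that contain a linked pair\<close>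

text \<open>For \<open>l\<close> at least 1 this is \<open>total\<close> times the probability that
  a stationary walk of length \<open>l\<close> is not good.\<close>

definition bad_weight :: "nat \<Rightarrow> real" where
  "bad_weight l = (\<Sum>w\<in>walks l. if good w then 0 else prob (tl w))"

text \<open>A linked pair other than the two ends survives the removal of the first or of the last
  vertex.\<close>

lemma good_if_ends_not_linked:
  assumes "walk w" "length w \<ge> 3" "good (tl w)" "good (butlast w)" "\<not> lk (hd w) (last w)"
  shows "good w"
proof (rule goodI)
  fix xs x ys y zs assume w: "w = xs @ x # ys @ y # zs" and ys: "ys \<noteq> []"
  consider "xs \<noteq> []" | "zs \<noteq> []" | "xs = []" "zs = []" by blast
  then show "\<not> lk x y"
  proof cases
    case 1
    then have "tl w = tl xs @ x # ys @ y # zs"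
      using w by simp
    then show ?thesis
      using good_not_linked assms(3) ys by metis
  next
    case 2
    then have "butlast w = xs @ x # ys @ y # butlast zs"
      using w by (simp add: butlast_append)
    then show ?thesis
      using good_not_linked assms(4) ys by metis
  next
    case 3
    then show ?thesis
      using assms(5) w by simp
  qed
qed (fact assms(1))

text \<open>The weighted bipartite bound is applied to the neighbours of \<open>y\<close> on one
  side and the ends of good walks from \<open>y\<close> on the other. Linked pairs contain no
  complete bipartite pattern, and no end carries much weight: at most \<open>B\<close> good walks
  lead to it, each of probability at most \<open>1 / d\<close>.\<close>

lemma linked_pairs_bound:
  assumes y: "y \<in> V" and l: "1 \<le> l" "l \<le> k"
  shows "(\<Sum>x\<in>nb y. sum prob {v \<in> {v \<in> walks_from l y. good v}. lk x (last v)}) \<le> eps * deg y"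
proof -
  let ?I = "{v \<in> walks_from l y. good v}"
  have "(\<Sum>x\<in>nb y. sum prob {v \<in> ?I. lk x (last v)}) \<le> real m + real (card (nb y)) * (eps / 2)"
  proof (rule weighted_bipartite_bound[where s = s and t = t and \<beta> = "real B / d"])
    have "sum prob ?I \<le> sum prob (walks_from l y)"
      by (intro sum_mono2) (auto simp: prob_nonneg)
    then show "sum prob ?I \<le> 1"
      using sum_prob_walks_from[OF y] by simp
    show "sum prob {v \<in> ?I. last v = z} \<le> real B / d" for z
    proof -
      have eq: "{v \<in> ?I. last v = z} = good_walks l y z"
        by (auto simp: walks_from_def good_walks_def good_imp_walk)
      have "sum prob (good_walks l y z) \<le> real (card (good_walks l y z)) * (1 / d)"
        using l by (intro sum_bounded_above prob_le_inverse) (auto simp: good_walks_def good_imp_walk)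
      also have "\<dots> \<le> real B * (1 / d)"
        using card_good_walks_le_path_bound[OF l] d_ge_1 by (intro mult_right_mono) auto
      finally show ?thesis
        unfolding eq by simp
    qed
    show "\<exists>x\<in>S. \<exists>z\<in>T. \<not> lk x z"
      if S: "S \<subseteq> nb y" "card S = s" and T: "finite T" "card T = t" "S \<inter> T = {}" for S T
    proof (rule ccontr)
      assume *: "\<not> (\<exists>x\<in>S. \<exists>z\<in>T. \<not> lk x z)"
      have "finite S"
        using S(1) finite_subset[OF _ finite_nb] by blast
      then obtain a where a: "bij_betw a {..<s} S"
        using ex_bij_betw_nat_finite S(2) by (metis atLeast0LessThan)
      obtain b where b: "bij_betw b {..<t} T"
        using ex_bij_betw_nat_finite[OF T(1)] T(2) by (metis atLeast0LessThan)
      have "has_subdivision s t k"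
      proof (rule linked_bipartite_imp_subdivision[of a s b t k L])
        show "lk (a i) (b j)" if "i < s" "j < t" for i j
          using * bij_betwE[OF a] bij_betwE[OF b] that by auto
      qed (use a b T(3) in \<open>auto simp: bij_betw_def blocker_size_def\<close>)
      then show False
        using no_subdivision by blast
    qed
    have "real B / d * (real m + 2 ^ m * real t) \<le> eps / 4"
      using d_ge(1) d_ge_1 by (simp add: field_simps)
    then have "real m * (real B / d * (real m + 2 ^ m * real t)) \<le> real m * (eps / 4)"
      by (rule mult_left_mono) simp
    moreover have "real B / d * real m * (real m + 2 ^ m * real t) =
        real m * (real B / d * (real m + 2 ^ m * real t))"
      by (simp only: mult_ac)
    ultimately show "real s + real B / d * real m * (real m + 2 ^ m * real t) \<le> real m * (eps / 2)"
      using m_ge by linarith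
  qed (auto simp: prob_nonneg m)
  also have "\<dots> \<le> eps / 2 * deg y + deg y * (eps / 2)"
  proof -
    have "eps / 2 * d \<le> eps / 2 * deg y"
      using deg_ge[OF y] eps by (intro mult_left_mono) auto
    then show ?thesis
      unfolding deg_def[symmetric] using d_ge(2) by linarith
  qed
  finally show ?thesis by simp
qed

text \<open>By reversibility, prefix and suffix of a walk contribute equally.\<close>

lemma bad_weight_Suc:
  assumes l: "1 \<le> l" "l \<le> k"
  shows "bad_weight (Suc l) \<le> 2 * bad_weight l + eps * total"
proof -
  \<comment> \<open>The three causes for a walk not to be good: a bad suffix, a bad prefix, or a
    good suffix together with linked ends.\<close>
  define f1 where "f1 w = (if good (tl w) then 0 else prob (tl w))" for w
  define f2 where "f2 w = (if good (butlast w) then 0 else prob (tl w))" for w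
  define f3 where "f3 w = (if good (tl w) \<and> lk (hd w) (last w) then prob (tl w) else 0)" for w
  have "bad_weight (Suc l) \<le> (\<Sum>w\<in>walks (Suc l). f1 w + f2 w + f3 w)"
    unfolding bad_weight_def
  proof (rule sum_mono)
    fix w assume "w \<in> walks (Suc l)"
    then have "walk w" "length w \<ge> 3"
      using l by (auto simp: walks_def)
    then have "good (tl w) \<Longrightarrow> good (butlast w) \<Longrightarrow> \<not> lk (hd w) (last w) \<Longrightarrow> good w"
      by (rule good_if_ends_not_linked)
    then show "(if good w then 0 else prob (tl w)) \<le> f1 w + f2 w + f3 w"
      using prob_nonneg[of "tl w"] by (auto simp: f1_def f2_def f3_def)
  qed
  also have "\<dots> = sum f1 (walks (Suc l)) + sum f2 (walks (Suc l)) + sum f3 (walks (Suc l))"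
    by (simp add: sum.distrib)
  \<comment> \<open>Summing over the \<open>deg (hd v)\<close> possible first vertices turns
    \<open>prob v\<close> into \<open>prob (tl v)\<close>, which is the invariance of the stationary
    measure.\<close>
  also have f1: "sum f1 (walks (Suc l)) = bad_weight l"
    unfolding sum_walks_Suc bad_weight_def
  proof (rule sum.cong[OF refl])
    fix v assume "v \<in> walks l"
    then have "walk v" "length v \<ge> 2"
      using l by (auto simp: walks_def)
    then show "(\<Sum>x\<in>nb (hd v). f1 (x # v)) = (if good v then 0 else prob (tl v))"
      by (simp add: f1_def prob_tl deg_def)
  qed
  also have "sum f2 (walks (Suc l)) = sum f1 (walks (Suc l))"
  proof (rule sum.reindex_bij_witness[where i = rev and j = rev])
    fix w :: "'a list"
    have "tl (rev w) = rev (butlast w)"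
      by (metis butlast_rev rev_rev_ident)
    then show "f1 (rev w) = f2 w"
      using prob_tl_rev[of w] by (simp add: f1_def f2_def)
  qed (auto simp: walks_def)
  also have "sum f3 (walks (Suc l)) \<le> eps * total"
  proof -
    have "sum f3 (walks (Suc l)) = (\<Sum>y\<in>V. \<Sum>v\<in>walks_from l y. \<Sum>x\<in>nb (hd v). f3 (x # v))"
      by (simp only: sum_walks_Suc) (rule sum_walks)
    also have "\<dots> = (\<Sum>y\<in>V. \<Sum>x\<in>nb y. sum prob {v \<in> {v \<in> walks_from l y. good v}. lk x (last v)})"
    proof (rule sum.cong[OF refl])
      fix y assume "y \<in> V"
      have "(\<Sum>v\<in>walks_from l y. \<Sum>x\<in>nb (hd v). f3 (x # v)) =
          (\<Sum>v\<in>walks_from l y. \<Sum>x\<in>nb y. if good v \<and> lk x (last v) then prob v else 0)"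
        by (intro sum.cong) (auto simp: walks_from_def f3_def)
      also have "\<dots> = (\<Sum>x\<in>nb y. \<Sum>v\<in>walks_from l y. if good v \<and> lk x (last v) then prob v else 0)"
        by (rule sum.swap)
      also have "\<dots> = (\<Sum>x\<in>nb y. sum prob {v \<in> {v \<in> walks_from l y. good v}. lk x (last v)})"
        by (simp add: sum.inter_filter[symmetric])
      finally show "(\<Sum>v\<in>walks_from l y. \<Sum>x\<in>nb (hd v). f3 (x # v)) = \<dots>" .
    qed
    also have "\<dots> \<le> (\<Sum>y\<in>V. eps * deg y)"
      using l by (intro sum_mono linked_pairs_bound)
    also have "\<dots> = eps * total"
      by (simp add: total_def sum_distrib_left)
    finally show ?thesis .
  qed
  finally show ?thesis
    by (simp add: f1)
qed

lemma total_nonneg: "total \<ge> 0"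
  unfolding total_def by (intro sum_nonneg deg_nonneg)

text \<open>Each step doubles the weight and adds \<open>eps * total\<close>. The start is 0, as a
  single edge leaves no room for a pair at distance 2.\<close>

lemma bad_weight_le:
  assumes "1 \<le> l" "l \<le> k"
  shows "bad_weight l \<le> (2 ^ l - 1) * (eps * total)"
  using assms
proof (induction l rule: nat_induct_at_least)
  case base
  have "good w" if "w \<in> walks 1" for w
  proof (rule goodI)
    fix xs x ys y zs assume "w = xs @ x # ys @ y # zs" "ys \<noteq> []"
    moreover from this have "length ys > 0" by simp
    moreover have "length w = 2"
      using that by (simp add: walks_def)
    ultimately show "\<not> lk x y" by simp
  qed (use that in \<open>simp add: walks_def\<close>)
  then have "bad_weight 1 = 0"
    by (simp add: bad_weight_def)
  then show ?case
    using total_nonneg eps by simp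
next
  case (Suc l)
  then have "bad_weight (Suc l) \<le> 2 * bad_weight l + eps * total" "bad_weight l \<le> (2 ^ l - 1) * (eps * total)"
    using bad_weight_Suc by simp_all
  then have "bad_weight (Suc l) \<le> 2 * ((2 ^ l - 1) * (eps * total)) + eps * total"
    by linarith
  also have "\<dots> = (2 ^ Suc l - 1) * (eps * total)"
    by (simp add: algebra_simps)
  finally show ?case .
qed

section \<open>Spiders of random walks\<close>

definition bad_prob :: "'a \<Rightarrow> real" where
  "bad_prob u = (\<Sum>w\<in>walks_from k u. if good w then 0 else prob w)"

text \<open>Earlier legs have at most \<open>s * Suc k\<close> vertices, a new leg has
  \<open>k\<close> positions after its start, and a good walk is at a given vertex in a given
  position with probability at most \<open>B / d\<close>.\<close>

definition hit_bound :: real where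
  "hit_bound = real (s * Suc k * k) * real B / d"

definition partial_spiders :: "nat \<Rightarrow> 'a \<Rightarrow> (nat \<Rightarrow> 'a list) set" where
  "partial_spiders n u = {ws \<in> extensional {..<n}.
     (\<forall>i<n. ws i \<in> walks_from k u \<and> good (ws i)) \<and>
     (\<forall>i<n. \<forall>j<n. i \<noteq> j \<longrightarrow> set (ws i) \<inter> set (ws j) = {u})}"

definition new_legs :: "nat \<Rightarrow> 'a \<Rightarrow> (nat \<Rightarrow> 'a list) \<Rightarrow> 'a list set" where
  "new_legs n u ws = {w \<in> walks_from k u. good w \<and> (\<forall>i<n. set (ws i) \<inter> set w = {u})}"

definition spider_prob :: "nat \<Rightarrow> (nat \<Rightarrow> 'a list) \<Rightarrow> real" where
  "spider_prob n ws = (\<Prod>i<n. prob (ws i))"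

lemma sum_bad_prob: "(\<Sum>u\<in>V. deg u * bad_prob u) = bad_weight k"
  unfolding bad_weight_def sum_walks bad_prob_def sum_distrib_left
proof (intro sum.cong refl)
  fix u w assume "w \<in> walks_from k u"
  then have "walk w" "length w \<ge> 2" "hd w = u"
    using k by (auto simp: walks_from_def)
  then show "deg u * (if good w then 0 else prob w) = (if good w then 0 else prob (tl w))"
    by (simp add: prob_tl)
qed

text \<open>Up to position \<open>j\<close> the walk is one of at most \<open>B\<close> good walks
  from \<open>u\<close> to \<open>x\<close>, each of probability at most \<open>1 / d\<close>; all
  continuations from \<open>x\<close> together have probability 1, whether good or not.\<close>

lemma sum_prob_through_le:
  assumes u: "u \<in> V" and j: "1 \<le> j" "j \<le> k"
  shows "sum prob {w \<in> walks_from k u. good w \<and> w ! j = x} \<le> real B / d"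
proof (cases "x \<in> V")
  case True
  let ?P = "good_walks j u x \<times> walks_from (k - j) x"
  have sub: "{w \<in> walks_from k u. good w \<and> w ! j = x} \<subseteq> (\<lambda>(p, r). p @ tl r) ` ?P"
  proof
    fix w assume w: "w \<in> {w \<in> walks_from k u. good w \<and> w ! j = x}"
    then have len: "length w = Suc k" and gw: "good w" and hd: "hd w = u" and wj: "w ! j = x"
      by (auto simp: walks_from_def)
    define p where "p = take (Suc j) w"
    define r where "r = drop j w"
    have r: "r = x # drop (Suc j) w"
      using Cons_nth_drop_Suc[of j w] j len wj by (simp add: r_def)
    have "w = take j w @ r"
      by (simp add: r_def)
    have "w = p @ tl r"
      using r by (simp add: p_def)
    have "p \<noteq> []"
      using len by (auto simp: p_def)
    moreover have "good p"
      using gw good_appendD1[of p "tl r"] \<open>w = p @ tl r\<close> \<open>p \<noteq> []\<close> by simp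
    moreover have "hd p = u" "last p = x" "length p = Suc j"
      using \<open>p \<noteq> []\<close> hd wj len j by (simp_all add: p_def take_Suc_conv_app_nth hd_append) (cases w; simp)+
    ultimately have "p \<in> good_walks j u x"
      by (simp add: good_walks_def)
    moreover have "walk r"
      using gw good_appendD2[of "take j w" r] \<open>w = take j w @ r\<close> r good_imp_walk by simp
    then have "r \<in> walks_from (k - j) x"
      using r len j by (simp add: walks_from_def Suc_diff_Suc)
    ultimately show "w \<in> (\<lambda>(p, r). p @ tl r) ` ?P"
      using \<open>w = p @ tl r\<close> by (intro image_eqI[of _ _ "(p, r)"]) auto
  qed
  have fin: "finite ?P"
    by (simp add: finite_good_walks)
  have "sum prob {w \<in> walks_from k u. good w \<and> w ! j = x} \<le> sum prob ((\<lambda>(p, r). p @ tl r) ` ?P)"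
    using fin sub by (intro sum_mono2) (auto simp: prob_nonneg)
  also have "\<dots> \<le> (\<Sum>(p, r)\<in>?P. prob (p @ tl r))"
    using sum_image_le[OF fin, of prob "\<lambda>(p, r). p @ tl r"] by (auto simp: prob_nonneg split_def o_def)
  also have "\<dots> = (\<Sum>p\<in>good_walks j u x. \<Sum>r\<in>walks_from (k - j) x. prob p * prob r)"
    unfolding sum.cartesian_product[symmetric]
  proof (intro sum.cong refl)
    fix p r assume "p \<in> good_walks j u x" "r \<in> walks_from (k - j) x"
    then have "p \<noteq> []" "last p = x" "r \<noteq> []" "hd r = x"
      by (auto simp: good_walks_def walks_from_def)
    moreover from this have "r = x # tl r"
      by (metis list.collapse)
    ultimately show "prob (p @ tl r) = prob p * prob r"
      by (metis prob_append)
  qed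
  also have "\<dots> = sum prob (good_walks j u x)"
    using sum_prob_walks_from[OF True] by (simp add: sum_distrib_left[symmetric])
  also have "\<dots> \<le> real (card (good_walks j u x)) * (1 / d)"
    using j by (intro sum_bounded_above prob_le_inverse) (auto simp: good_walks_def good_imp_walk)
  also have "\<dots> \<le> real B * (1 / d)"
    using card_good_walks_le_path_bound[OF j] d_ge_1 by (intro mult_right_mono) auto
  finally show ?thesis by simp
next
  case False
  have empty: "{w \<in> walks_from k u. good w \<and> w ! j = x} = {}"
  proof -
    have "w ! j \<in> V" if "w \<in> walks_from k u" for w
      using that j nth_mem[of j w] by (auto simp: walks_from_def walk_def)
    then show ?thesis
      using False by blast
  qed
  show ?thesis
    unfolding empty using d_ge_1 by simp
qed

text \<open>Union bound: a walk from \<open>u\<close> that fails as a new leg is not good or meets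
  an earlier leg outside \<open>u\<close>. Such a meeting has position at least 1, since position 0
  is \<open>u\<close> itself.\<close>

lemma sum_new_legs_ge:
  assumes u: "u \<in> V" and n: "n < s" and ws: "ws \<in> partial_spiders n u"
  shows "1 - bad_prob u - hit_bound \<le> sum prob (new_legs n u ws)"
proof -
  define X where "X = (\<Union>i<n. set (ws i)) - {u}"
  have finX: "finite X"
    by (simp add: X_def)
  have "card X \<le> card (\<Union>i<n. set (ws i))"
    unfolding X_def by (intro card_mono) auto
  also have "\<dots> \<le> (\<Sum>i<n. card (set (ws i)))"
    by (rule card_UN_le) simp
  also have "\<dots> \<le> (\<Sum>i<n. Suc k)"
  proof (rule sum_mono)
    fix i assume "i \<in> {..<n}"
    then have "length (ws i) = Suc k"
      using ws by (auto simp: partial_spiders_def walks_from_def)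
    then show "card (set (ws i)) \<le> Suc k"
      using card_length[of "ws i"] by simp
  qed
  also have "\<dots> = n * Suc k"
    by simp
  also have "\<dots> \<le> s * Suc k"
    using n by (intro mult_right_mono) auto
  finally have cardX: "card X \<le> s * Suc k" .
  have "1 = sum prob (walks_from k u)"
    using sum_prob_walks_from[OF u] by simp
  also have "\<dots> \<le> (\<Sum>w\<in>walks_from k u. (if w \<in> new_legs n u ws then prob w else 0) +
      (if good w then 0 else prob w) + (\<Sum>(x, j)\<in>X \<times> {1..k}. if good w \<and> w ! j = x then prob w else 0))"
  proof (rule sum_mono)
    fix w assume w: "w \<in> walks_from k u"
    have nonneg: "0 \<le> (\<Sum>(x, j)\<in>X \<times> {1..k}. if good w \<and> w ! j = x then prob w else 0)"
      by (intro sum_nonneg) (auto simp: prob_nonneg)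
    show "prob w \<le> (if w \<in> new_legs n u ws then prob w else 0) + (if good w then 0 else prob w) +
        (\<Sum>(x, j)\<in>X \<times> {1..k}. if good w \<and> w ! j = x then prob w else 0)"
    proof (cases "w \<in> new_legs n u ws \<or> \<not> good w")
      case True
      then show ?thesis
        using nonneg prob_nonneg[of w] by auto
    next
      case False
      have len: "length w = Suc k" and hd: "hd w = u" and "w \<noteq> []"
        using w by (auto simp: walks_from_def)
      have uw: "u \<in> set w"
        using hd \<open>w \<noteq> []\<close> by auto
      obtain i where i: "i < n" "set (ws i) \<inter> set w \<noteq> {u}"
        using False w by (auto simp: new_legs_def)
      have "ws i \<noteq> []" "hd (ws i) = u"
        using ws i by (auto simp: partial_spiders_def walks_from_def)
      then have "u \<in> set (ws i)"
        using hd_in_set by blast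
      then obtain x where x: "x \<in> set (ws i)" "x \<in> set w" "x \<noteq> u"
        using i(2) uw by blast
      then obtain j where j: "j < length w" "w ! j = x"
        by (auto simp: in_set_conv_nth)
      then have "j \<noteq> 0"
        using x(3) hd \<open>w \<noteq> []\<close> by (metis hd_conv_nth)
      then have xj: "(x, j) \<in> X \<times> {1..k}"
        using x i(1) j len by (auto simp: X_def)
      have "prob w = (case (x, j) of (x, j) \<Rightarrow> if good w \<and> w ! j = x then prob w else 0)"
        using False j by simp
      also have "\<dots> \<le> (\<Sum>(x, j)\<in>X \<times> {1..k}. if good w \<and> w ! j = x then prob w else 0)"
      proof (rule member_le_sum[OF xj])
        show "0 \<le> (case z of (x, j) \<Rightarrow> if good w \<and> w ! j = x then prob w else 0)" for z
          by (cases z) (simp add: prob_nonneg)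
      qed (use finX in simp)
      finally show ?thesis
        using False by simp
    qed
  qed
  also have "\<dots> = sum prob (new_legs n u ws) + bad_prob u +
      (\<Sum>w\<in>walks_from k u. \<Sum>(x, j)\<in>X \<times> {1..k}. if good w \<and> w ! j = x then prob w else 0)"
  proof -
    have "{w \<in> walks_from k u. w \<in> new_legs n u ws} = new_legs n u ws"
      by (auto simp: new_legs_def)
    then have "(\<Sum>w\<in>walks_from k u. if w \<in> new_legs n u ws then prob w else 0) = sum prob (new_legs n u ws)"
      using sum.inter_filter[of "walks_from k u" prob "\<lambda>w. w \<in> new_legs n u ws"] by simp
    then show ?thesis
      by (simp add: sum.distrib bad_prob_def)
  qed
  also have "(\<Sum>w\<in>walks_from k u. \<Sum>(x, j)\<in>X \<times> {1..k}. if good w \<and> w ! j = x then prob w else 0) =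
      (\<Sum>(x, j)\<in>X \<times> {1..k}. sum prob {w \<in> walks_from k u. good w \<and> w ! j = x})"
    unfolding split_def by (subst sum.swap) (simp add: sum.inter_filter)
  also have "\<dots> \<le> real (card (X \<times> {1..k})) * (real B / d)"
    using sum_prob_through_le[OF u] by (intro sum_bounded_above) auto
  also have "\<dots> \<le> real (s * Suc k * k) * (real B / d)"
  proof (rule mult_right_mono)
    have "card (X \<times> {1..k}) \<le> s * Suc k * k"
      using cardX by (simp add: card_cartesian_product mult_right_mono del: mult_Suc_right)
    then show "real (card (X \<times> {1..k})) \<le> real (s * Suc k * k)"
      by (rule of_nat_mono)
  qed (use d_ge_1 in simp)
  finally show ?thesis
    by (simp add: hit_bound_def)
qed

lemma finite_partial_spiders [simp]: "finite (partial_spiders n u)"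
proof (rule finite_subset)
  show "partial_spiders n u \<subseteq> PiE {..<n} (\<lambda>_. walks_from k u)"
  proof
    fix ws assume "ws \<in> partial_spiders n u"
    then have "ws \<in> extensional {..<n}" "\<forall>i<n. ws i \<in> walks_from k u"
      by (simp_all add: partial_spiders_def)
    then show "ws \<in> PiE {..<n} (\<lambda>_. walks_from k u)"
      by (simp add: PiE_iff)
  qed
qed (simp add: finite_PiE)

lemma finite_new_legs [simp]: "finite (new_legs n u ws)"
  by (simp add: new_legs_def)

lemma spider_prob_nonneg: "spider_prob n ws \<ge> 0"
  unfolding spider_prob_def by (intro prod_nonneg) (simp add: prob_nonneg)

lemma sum_partial_spiders_Suc:
  "sum (spider_prob (Suc n)) (partial_spiders (Suc n) u) =
     (\<Sum>ws\<in>partial_spiders n u. spider_prob n ws * sum prob (new_legs n u ws))"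
proof -
  have "bij_betw (\<lambda>(ws, w). ws(n := w)) (Sigma (partial_spiders n u) (new_legs n u))
      (partial_spiders (Suc n) u)"
  \<comment> \<open>Resetting entry \<open>n\<close> to \<open>undefined\<close> restores
    extensionality on the first \<open>n\<close> indices, so that adding a leg is a
    bijection.\<close>
  proof (rule bij_betwI[where g = "\<lambda>ws. (ws(n := undefined), ws n)"])
    show "(\<lambda>(ws, w). ws(n := w)) \<in> Sigma (partial_spiders n u) (new_legs n u) \<rightarrow> partial_spiders (Suc n) u"
    proof (rule funcsetI, clarify)
      fix ws w assume "ws \<in> partial_spiders n u" "w \<in> new_legs n u ws"
      then have ws: "ws \<in> extensional {..<n}" "\<forall>i<n. ws i \<in> walks_from k u \<and> good (ws i)"
        "\<forall>i<n. \<forall>j<n. i \<noteq> j \<longrightarrow> set (ws i) \<inter> set (ws j) = {u}"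
        and w: "w \<in> walks_from k u" "good w" "\<forall>i<n. set (ws i) \<inter> set w = {u}"
        by (simp_all add: partial_spiders_def new_legs_def)
      have "ws(n := w) \<in> extensional {..<Suc n}"
        using ws(1) by (simp add: extensional_def)
      moreover have "\<forall>i<n. set w \<inter> set (ws i) = {u}"
        using w(3) by (simp add: Int_commute)
      ultimately show "ws(n := w) \<in> partial_spiders (Suc n) u"
        unfolding partial_spiders_def mem_Collect_eq using ws(2,3) w by (simp add: All_less_Suc)
    qed
    show "(\<lambda>ws. (ws(n := undefined), ws n)) \<in> partial_spiders (Suc n) u \<rightarrow> Sigma (partial_spiders n u) (new_legs n u)"
    proof (rule funcsetI)
      fix ws assume "ws \<in> partial_spiders (Suc n) u"
      then have ws: "ws \<in> extensional {..<Suc n}" "\<forall>i<Suc n. ws i \<in> walks_from k u \<and> good (ws i)"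
        "\<forall>i<Suc n. \<forall>j<Suc n. i \<noteq> j \<longrightarrow> set (ws i) \<inter> set (ws j) = {u}"
        by (simp_all add: partial_spiders_def)
      have "ws(n := undefined) \<in> extensional {..<n}"
        using ws(1) by (simp add: extensional_def)
      then have "ws(n := undefined) \<in> partial_spiders n u"
        unfolding partial_spiders_def mem_Collect_eq using ws(2,3) by simp
      moreover have "ws n \<in> new_legs n u (ws(n := undefined))"
        unfolding new_legs_def mem_Collect_eq using ws(2,3) by simp
      ultimately show "(ws(n := undefined), ws n) \<in> Sigma (partial_spiders n u) (new_legs n u)"
        by blast
    qed
    show "\<And>x. x \<in> Sigma (partial_spiders n u) (new_legs n u) \<Longrightarrow>
        (((\<lambda>(ws, w). ws(n := w)) x)(n := undefined), (\<lambda>(ws, w). ws(n := w)) x n) = x"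
      by (auto simp: partial_spiders_def extensional_def fun_eq_iff)
  qed auto
  then have "sum (spider_prob (Suc n)) (partial_spiders (Suc n) u) =
      (\<Sum>(ws, w)\<in>Sigma (partial_spiders n u) (new_legs n u). spider_prob (Suc n) (ws(n := w)))"
    by (simp add: sum.reindex_bij_betw[symmetric] split_def)
  also have "\<dots> = (\<Sum>ws\<in>partial_spiders n u. \<Sum>w\<in>new_legs n u ws. spider_prob n ws * prob w)"
    by (subst sum.Sigma[symmetric]) (simp_all add: spider_prob_def)
  finally show ?thesis
    by (simp add: sum_distrib_left)
qed

lemma bad_prob_nonneg: "bad_prob u \<ge> 0"
  unfolding bad_prob_def by (intro sum_nonneg) (simp add: prob_nonneg)

lemma hit_bound_nonneg: "hit_bound \<ge> 0"
  unfolding hit_bound_def using d_ge_1 by simp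

text \<open>Each new leg costs at most \<open>bad_prob u + hit_bound\<close>. The upper bound 1 is
  carried along because the loss in a step is this cost times the weight reached so far.\<close>

lemma sum_spider_prob:
  assumes u: "u \<in> V" and "n \<le> s"
  shows "1 - real n * (bad_prob u + hit_bound) \<le> sum (spider_prob n) (partial_spiders n u) \<and>
    sum (spider_prob n) (partial_spiders n u) \<le> 1"
  using \<open>n \<le> s\<close>
proof (induction n)
  case 0
  have "partial_spiders 0 u = {\<lambda>_. undefined}"
    by (auto simp: partial_spiders_def)
  then show ?case
    by (simp add: spider_prob_def)
next
  case (Suc n)
  let ?S = "sum (spider_prob n) (partial_spiders n u)" and ?e = "bad_prob u + hit_bound"
  have IH: "1 - real n * ?e \<le> ?S" "?S \<le> 1"
    using Suc by auto
  have "1 - real (Suc n) * ?e \<le> ?S - ?e"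
    using IH by (simp add: algebra_simps)
  also have "\<dots> \<le> ?S - ?S * ?e"
    using IH bad_prob_nonneg[of u] hit_bound_nonneg mult_right_mono[of ?S 1 ?e] by simp
  also have "\<dots> = (\<Sum>ws\<in>partial_spiders n u. spider_prob n ws * (1 - ?e))"
    unfolding sum_distrib_right[symmetric] by (simp only: right_diff_distrib mult_1_right)
  also have "\<dots> \<le> (\<Sum>ws\<in>partial_spiders n u. spider_prob n ws * sum prob (new_legs n u ws))"
    using sum_new_legs_ge[OF u, of n] Suc.prems
    by (intro sum_mono mult_left_mono) (auto simp: spider_prob_nonneg diff_diff_eq)
  finally have 1: "1 - real (Suc n) * ?e \<le> sum (spider_prob (Suc n)) (partial_spiders (Suc n) u)"
    unfolding sum_partial_spiders_Suc .
  have "sum prob (new_legs n u ws) \<le> 1" for ws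
  proof -
    have "sum prob (new_legs n u ws) \<le> sum prob (walks_from k u)"
      by (intro sum_mono2) (auto simp: new_legs_def prob_nonneg)
    then show ?thesis
      using sum_prob_walks_from[OF u] by simp
  qed
  then have "(\<Sum>ws\<in>partial_spiders n u. spider_prob n ws * sum prob (new_legs n u ws)) \<le>
      (\<Sum>ws\<in>partial_spiders n u. spider_prob n ws * 1)"
    by (intro sum_mono mult_left_mono) (auto simp: spider_prob_nonneg)
  then have "sum (spider_prob (Suc n)) (partial_spiders (Suc n) u) \<le> 1"
    unfolding sum_partial_spiders_Suc using IH(2) by simp
  with 1 show ?case ..
qed

section \<open>Probability of spiders against their number\<close>

text \<open>The weight \<open>deg u\<close> cancels against the starting factor of leg 0, whose
  other \<open>k - 1\<close> factors are at most \<open>1 / d\<close>; each of the remaining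
  \<open>s - 1\<close> legs gives \<open>k\<close> such factors, so there are
  \<open>s * k - 1\<close> in total.\<close>

lemma spider_prob_le:
  assumes u: "u \<in> V" and ws: "ws \<in> partial_spiders s u"
  shows "deg u * spider_prob s ws \<le> (1 / d) ^ (s * k - 1)"
proof -
  have w: "prob (ws i) \<le> 1 / deg u * (1 / d) ^ (k - 1)" if "i < s" for i
  proof -
    have "ws i \<in> walks_from k u"
      using ws that by (simp add: partial_spiders_def)
    then show ?thesis
      using prob_le[of "ws i" "k - 1"] k by (simp add: walks_from_def)
  qed
  have le: "1 / deg u * (1 / d) ^ (k - 1) \<le> (1 / d) ^ k"
  proof -
    have "1 / deg u * (1 / d) ^ (k - 1) \<le> 1 / d * (1 / d) ^ (k - 1)"
      using deg_ge[OF u] d_ge_1 by (intro mult_right_mono divide_left_mono) auto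
    also have "\<dots> = (1 / d) ^ k"
      using k by (cases k) auto
    finally show ?thesis .
  qed
  obtain r where r: "s = Suc r"
    using s by (cases s) auto
  have "spider_prob s ws = prob (ws 0) * (\<Prod>i<r. prob (ws (Suc i)))"
    unfolding spider_prob_def r by (rule prod.lessThan_Suc_shift)
  also have "\<dots> \<le> (1 / deg u * (1 / d) ^ (k - 1)) * (\<Prod>i<r. (1 / d) ^ k)"
  proof (intro mult_mono prod_mono conjI)
    fix i assume "i \<in> {..<r}"
    then show "prob (ws (Suc i)) \<le> (1 / d) ^ k"
      using w[of "Suc i"] le r by simp
  qed (use w[of 0] r d_ge_1 deg_nonneg in \<open>auto simp: prob_nonneg intro!: prod_nonneg mult_nonneg_nonneg\<close>)
  finally have "deg u * spider_prob s ws \<le> deg u * ((1 / deg u * (1 / d) ^ (k - 1)) * (\<Prod>i<r. (1 / d) ^ k))"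
    using deg_nonneg by (rule mult_left_mono)
  also have "\<dots> = (1 / d) ^ (k - 1 + k * r)"
    using deg_pos[OF u] by (simp add: power_add power_mult)
  also have "k - 1 + k * r = s * k - 1"
    using k r by (simp add: algebra_simps)
  finally show ?thesis .
qed

text \<open>Spiders are sorted by their leaves, and the recursion depth \<open>s * k\<close> is the
  total length of the legs. The centre can be read off a spider, so none is counted for two
  centres.\<close>

lemma sum_card_partial_spiders_le:
  "(\<Sum>u\<in>V. card (partial_spiders s u)) \<le> card V ^ s * spider_bound L B s k (s * k)"
proof -
  have hd: "hd (ws 0) = u" if "ws \<in> partial_spiders s u" for ws u
    using that s by (simp add: partial_spiders_def walks_from_def)
  have "(\<Sum>u\<in>V. card (partial_spiders s u)) = card (\<Union>u\<in>V. partial_spiders s u)"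
  proof (rule card_UN_disjoint[symmetric])
    show "\<forall>u\<in>V. \<forall>u'\<in>V. u \<noteq> u' \<longrightarrow> partial_spiders s u \<inter> partial_spiders s u' = {}"
      using hd by blast
  qed (use finite_V in auto)
  also have "\<dots> \<le> card (\<Union>v\<in>PiE {..<s} (\<lambda>_. V). good_spiders v (\<lambda>_. k))"
  proof (rule card_mono)
    show "finite (\<Union>v\<in>PiE {..<s} (\<lambda>_. V). good_spiders v (\<lambda>_. k))"
      using finite_V by (intro finite_UN_I finite_PiE) (auto simp: finite_good_spiders)
    show "(\<Union>u\<in>V. partial_spiders s u) \<subseteq> (\<Union>v\<in>PiE {..<s} (\<lambda>_. V). good_spiders v (\<lambda>_. k))"
    proof clarify
      fix u ws assume ws: "ws \<in> partial_spiders s u"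
      have ws': "ws \<in> extensional {..<s}" "\<forall>i<s. ws i \<in> walks_from k u \<and> good (ws i)"
        "\<forall>i<s. \<forall>j<s. i \<noteq> j \<longrightarrow> set (ws i) \<inter> set (ws j) = {u}"
        using ws by (simp_all add: partial_spiders_def)
      define v where "v = restrict (\<lambda>i. last (ws i)) {..<s}"
      have "last (ws i) \<in> V" if "i < s" for i
      proof -
        have "ws i \<noteq> []" "set (ws i) \<subseteq> V"
          using ws'(2) that by (auto simp: walks_from_def walk_def)
        then show ?thesis
          using last_in_set by blast
      qed
      then have "v \<in> PiE {..<s} (\<lambda>_. V)"
        by (auto simp: v_def)
      moreover have "ws \<in> good_spiders v (\<lambda>_. k)"
        unfolding good_spiders_def mem_Collect_eq hd[OF ws]
        using ws' by (simp add: v_def good_walks_def walks_from_def)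
      ultimately show "ws \<in> (\<Union>v\<in>PiE {..<s} (\<lambda>_. V). good_spiders v (\<lambda>_. k))"
        by blast
    qed
  qed
  also have "\<dots> \<le> (\<Sum>v\<in>PiE {..<s} (\<lambda>_. V). card (good_spiders v (\<lambda>_. k)))"
    using finite_V by (intro card_UN_le finite_PiE) auto
  also have "\<dots> \<le> (\<Sum>v\<in>PiE {..<s} (\<lambda>_. V). spider_bound L B s k (s * k))"
    using k by (intro sum_mono card_good_spiders_le) auto
  also have "\<dots> = card V ^ s * spider_bound L B s k (s * k)"
    by (simp add: card_PiE)
  finally show ?thesis .
qed

theorem min_degree_power_le:
  assumes "V \<noteq> {}"
  shows "d ^ (s * k) \<le> 2 * real (spider_bound L B s k (s * k)) * real (card V) ^ (s - 1)"
proof -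
  let ?M = "real (spider_bound L B s k (s * k))" and ?n = "real (card V)"
  have n: "?n > 0"
    using assms finite_V by (simp add: card_gt_0_iff)
  have total: "?n * d \<le> total"
    unfolding total_def using deg_ge by (rule sum_bounded_below)
  have sk: "s * k \<ge> 1"
    using s k by (simp add: Suc_le_eq)
  have "real s * bad_weight k \<le> real s * (2 ^ k * (eps * total))"
  proof (rule mult_left_mono)
    have "(2 ^ k - 1) * (eps * total) \<le> 2 ^ k * (eps * total)"
      using eps total_nonneg by (intro mult_right_mono) auto
    then show "bad_weight k \<le> 2 ^ k * (eps * total)"
      using bad_weight_le[OF k order_refl] by linarith
  qed simp
  also have "\<dots> = real s * 2 ^ k * eps * total"
    by simp
  also have "\<dots> \<le> 1 / 4 * total"
    using eps_le total_nonneg by (rule mult_right_mono)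
  finally have 1: "real s * bad_weight k \<le> total / 4" by simp
  have "real s * hit_bound \<le> 1 / 4"
    unfolding hit_bound_def using d_ge' d_ge_1 by (simp add: field_simps)
  then have "real s * hit_bound * total \<le> 1 / 4 * total"
    using total_nonneg by (rule mult_right_mono)
  then have 2: "real s * hit_bound * total \<le> total / 4" by simp
  \<comment> \<open>A quarter of \<open>total\<close> goes to walks that are not good and a quarter
    to collisions.\<close>
  have "total / 2 \<le> total - real s * bad_weight k - real s * hit_bound * total"
    using 1 2 by linarith
  also have "\<dots> = (\<Sum>u\<in>V. deg u * (1 - real s * (bad_prob u + hit_bound)))"
    unfolding sum_bad_prob[symmetric] total_def
    by (simp add: algebra_simps sum.distrib sum_subtractf sum_distrib_left sum_distrib_right)
  also have "\<dots> \<le> (\<Sum>u\<in>V. deg u * sum (spider_prob s) (partial_spiders s u))"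
    using sum_spider_prob by (intro sum_mono mult_left_mono) (auto simp: deg_nonneg)
  also have "\<dots> \<le> (\<Sum>u\<in>V. real (card (partial_spiders s u)) * (1 / d) ^ (s * k - 1))"
    unfolding sum_distrib_left using spider_prob_le by (intro sum_mono sum_bounded_above)
  also have "\<dots> = real (\<Sum>u\<in>V. card (partial_spiders s u)) * (1 / d) ^ (s * k - 1)"
    by (simp add: sum_distrib_right)
  also have "\<dots> \<le> real (card V ^ s * spider_bound L B s k (s * k)) * (1 / d) ^ (s * k - 1)"
    using of_nat_mono[OF sum_card_partial_spiders_le] d_ge_1 by (intro mult_right_mono) auto
  finally have "?n * d / 2 \<le> ?n ^ s * ?M * (1 / d) ^ (s * k - 1)"
    using total by simp
  then have "?n * d / 2 * d ^ (s * k - 1) \<le> ?n ^ s * ?M * (1 / d) ^ (s * k - 1) * d ^ (s * k - 1)"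
    using d_ge_1 by (intro mult_right_mono) auto
  also have "\<dots> = ?n ^ s * ?M"
    using d_ge_1 by (simp add: power_one_over)
  \<comment> \<open>The factor \<open>d\<close> contributed by \<open>total\<close> completes the
    exponent \<open>s * k\<close>.\<close>
  also have "?n * d / 2 * d ^ (s * k - 1) = ?n * (d ^ (s * k) / 2)"
    using sk by (simp add: power_eq_if[of d "s * k"])
  also have "?n ^ s * ?M = ?n * (?n ^ (s - 1) * ?M)"
    using s by (simp add: power_eq_if[of ?n s])
  finally have "d ^ (s * k) / 2 \<le> ?n ^ (s - 1) * ?M"
    using n by simp
  then show ?thesis
    by (simp add: mult_ac)
qed

end

section \<open>The extremal number\<close>

text \<open>In a smallest vertex set spanning more than \<open>c\<close> edges per vertex, no vertex
  has degree below \<open>c\<close>, since removing it would keep this density.\<close>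

lemma exists_min_degree_subgraph:
  assumes G: "simple_graph G" and c: "c \<ge> 0" and many: "c * real (card (verts G)) < real (card (edges G))"
  shows "\<exists>U\<subseteq>verts G. U \<noteq> {} \<and> (\<forall>x\<in>U. c \<le> real (card {y \<in> U. {x, y} \<in> edges G}))"
proof -
  define ind where "ind U = {e \<in> edges G. e \<subseteq> U}" for U
  define dense where "dense U \<longleftrightarrow> U \<subseteq> verts G \<and> c * real (card U) < real (card (ind U))" for U
  have fin: "finite (verts G)" and e: "\<And>e. e \<in> edges G \<Longrightarrow> e \<subseteq> verts G \<and> card e = 2"
    using G by (auto simp: simple_graph_def)
  have fin_edges: "finite (edges G)"
    using finite_subset[of "edges G" "Pow (verts G)"] fin e by blast
  have "ind (verts G) = edges G"
    using e by (auto simp: ind_def)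
  then have "dense (verts G)"
    using many by (simp add: dense_def)
  then obtain U where U: "dense U" and min: "\<And>U'. dense U' \<Longrightarrow> card U \<le> card U'"
    using ex_has_least_nat[of dense "verts G" card] by blast
  have finU: "finite U"
    using U fin finite_subset by (auto simp: dense_def)
  have "U \<noteq> {}"
  proof
    assume "U = {}"
    moreover have "ind {} = {}"
      using e by (fastforce simp: ind_def)
    ultimately show False
      using U by (simp add: dense_def)
  qed
  moreover have "c \<le> real (card {y \<in> U. {x, y} \<in> edges G})" if x: "x \<in> U" for x
  proof -
    let ?N = "{y \<in> U. {x, y} \<in> edges G}"
    have card: "card U = Suc (card (U - {x}))"
      using finU x by (rule card.remove)
    then have "\<not> dense (U - {x})"
      using min[of "U - {x}"] by auto
    then have 1: "real (card (ind (U - {x}))) \<le> c * real (card (U - {x}))"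
      using U by (auto simp: dense_def)
    have "ind U \<subseteq> ind (U - {x}) \<union> (\<lambda>y. {x, y}) ` ?N"
    proof
      fix f assume f: "f \<in> ind U"
      show "f \<in> ind (U - {x}) \<union> (\<lambda>y. {x, y}) ` ?N"
      proof (cases "x \<in> f")
        case True
        have "card f = 2"
          using f e by (auto simp: ind_def)
        then obtain y where "f = {x, y}"
          using True by (auto simp: card_2_iff)
        then show ?thesis
          using f by (auto simp: ind_def)
      qed (use f in \<open>auto simp: ind_def\<close>)
    qed
    then have "card (ind U) \<le> card (ind (U - {x}) \<union> (\<lambda>y. {x, y}) ` ?N)"
      using fin_edges finU by (intro card_mono) (auto simp: ind_def)
    also have "\<dots> \<le> card (ind (U - {x})) + card ?N"
      using card_Un_le[of "ind (U - {x})" "(\<lambda>y. {x, y}) ` ?N"] card_image_le[of ?N "\<lambda>y. {x, y}"] finU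
      by simp
    finally have "real (card (ind U)) \<le> real (card (ind (U - {x}))) + real (card ?N)"
      by linarith
    moreover have "c * real (card U) = c * real (card (U - {x})) + c"
      using card by (simp add: algebra_simps)
    moreover have "c * real (card U) < real (card (ind U))"
      using U by (simp add: dense_def)
    ultimately show ?thesis
      using 1 by linarith
  qed
  ultimately show ?thesis
    using U by (auto simp: dense_def)
qed

lemma subdivision_imp_contains:
  fixes G :: "nat graph"
  assumes "adjacency V E" and sub: "adjacency.has_subdivision V E s t k" and "s \<ge> 1" "t \<ge> 1"
    and V: "V \<subseteq> verts G" and E: "\<And>x y. E x y \<Longrightarrow> {x, y} \<in> edges G"
  shows "\<exists>H\<in>subdivided_bipartite_family k s t. contains_graph G H"
proof -
  interpret adjacency V E by fact
  obtain a b p where inj: "inj_on a {..<s}" "inj_on b {..<t}" "a ` {..<s} \<inter> b ` {..<t} = {}"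
    and p': "\<forall>i<s. \<forall>j<t. path_between k (a i) (b j) (p i j) \<and>
        inner_verts (p i j) \<inter> (a ` {..<s} \<union> b ` {..<t}) = {}"
    and disj': "\<forall>i<s. \<forall>j<t. \<forall>i'<s. \<forall>j'<t. (i, j) \<noteq> (i', j') \<longrightarrow>
        inner_verts (p i j) \<inter> inner_verts (p i' j') = {}"
    using sub unfolding has_subdivision_def by (elim exE conjE) (rule that)
  have p: "path_between k (a i) (b j) (p i j)"
    and p_inner: "inner_verts (p i j) \<inter> (a ` {..<s} \<union> b ` {..<t}) = {}" if "i < s" "j < t" for i j
    using p' that by simp_all
  let ?F = "complete_bipartite s t"
  define f where "f = case_sum a b"
  \<comment> \<open>Edges are unordered sets, but the tags \<open>Inl\<close> and \<open>Inr\<close>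
    determine both indices.\<close>
  define P where "P e = p (THE i. Inl i \<in> e) (THE j. Inr j \<in> e)" for e :: "(nat + nat) set"
  have P: "P {Inl i, Inr j} = p i j" for i j
    by (simp add: P_def)
  have fF: "f ` verts ?F = a ` {..<s} \<union> b ` {..<t}"
    by (auto simp: f_def complete_bipartite_def image_Un image_image)
  have edge: "\<exists>i j. e = {Inl i, Inr j} \<and> i < s \<and> j < t" if "e \<in> edges ?F" for e
    using that by (auto simp: complete_bipartite_def)
  define H where "H = \<lparr>verts = f ` verts ?F \<union> (\<Union>e\<in>edges ?F. set (P e)),
    edges = (\<Union>e\<in>edges ?F. path_edges (P e))\<rparr>"
  have "path_replacement k ?F H"
    unfolding path_replacement_def
  proof (intro exI[of _ f] exI[of _ P] conjI ballI impI)
    show "inj_on f (verts ?F)"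
    proof (rule inj_onI)
      fix x y assume "x \<in> verts ?F" "y \<in> verts ?F" "f x = f y"
      then show "x = y"
        using inj by (cases x; cases y)
          (auto simp: f_def complete_bipartite_def disjoint_iff dest: inj_onD)
    qed
    fix e assume "e \<in> edges ?F"
    then obtain i j where e: "e = {Inl i, Inr j}" "i < s" "j < t"
      using edge by blast
    show "is_path (P e)" "path_length (P e) \<le> k" "{hd (P e), last (P e)} = f ` e"
      using p[OF e(2,3)] by (auto simp: e P is_path_def path_length_def path_between_def walk_def f_def)
    show "inner_verts (P e) \<inter> f ` verts ?F = {}"
      unfolding fF using p_inner[OF e(2,3)] by (simp add: e P)
    fix e' assume "e' \<in> edges ?F" and ne: "e \<noteq> e'"
    then obtain i' j' where e': "e' = {Inl i', Inr j'}" "i' < s" "j' < t"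
      using edge by blast
    have "(i, j) \<noteq> (i', j')"
      using ne e e' by auto
    then show "inner_verts (P e) \<inter> inner_verts (P e') = {}"
      using disj' e(2,3) e'(2,3) by (simp add: e e' P)
  qed (simp_all add: H_def)
  moreover have "contains_graph G H"
    unfolding contains_graph_def
  \<comment> \<open>\<open>H\<close> is built on vertices of \<open>G\<close> itself, so the
    identity embeds it.\<close>
  proof (intro exI[of _ id] conjI ballI)
    have set_p: "set (p i j) \<subseteq> V" if "i < s" "j < t" for i j
      using p[OF that] by (simp add: path_between_def walk_def)
    have "a i \<in> V" if "i < s" for i
      using p[OF that, of 0] path_between_ends set_p[OF that, of 0] assms(4) by (simp add: subset_iff)
    moreover have "b j \<in> V" if "j < t" for j
      using p[OF _ that, of 0] path_between_ends set_p[OF _ that, of 0] assms(3) by (simp add: subset_iff)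
    ultimately have "f ` verts ?F \<subseteq> V"
      unfolding fF by blast
    moreover have "set (P e) \<subseteq> V" if "e \<in> edges ?F" for e
      using edge[OF that] set_p by (auto simp: P subset_iff)
    ultimately have "verts H \<subseteq> V"
      by (simp add: H_def UN_subset_iff)
    then show "id ` verts H \<subseteq> verts G"
      using V by simp
    fix f assume "f \<in> edges H"
    then obtain e where "e \<in> edges ?F" "f \<in> path_edges (P e)"
      by (auto simp: H_def)
    then obtain i j n where n: "i < s" "j < t" "Suc n < length (p i j)" "f = {p i j ! n, p i j ! Suc n}"
      using edge[of e] by (auto simp: path_edges_def P)
    have "successively E (p i j)"
      using p[OF n(1,2)] by (simp add: path_between_def walk_def)
    then have "E (p i j ! n) (p i j ! Suc n)"
      using n(3) by (simp add: successively_conv_nth)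
    then show "id ` f \<in> edges G"
      using E n(4) by simp
  qed simp
  ultimately show ?thesis
    unfolding subdivided_bipartite_family_def by blast
qed

theorem proposition4p1:
  fixes s t k :: nat
  assumes "s \<ge> 2" and "t \<ge> 2" and "k \<ge> 2"
  shows "(\<lambda>n. real (extremal_number n (subdivided_bipartite_family k s t)))
           \<in> O(\<lambda>n. real n powr (1 + 1 / real k - 1 / (real s * real k)))"
proof -
  let ?\<H> = "subdivided_bipartite_family k s t"
  \<comment> \<open>\<open>eps\<close> and \<open>m\<close> are the values that turn
    \<open>eps_le\<close> and \<open>m_ge\<close> into equalities.\<close>
  define eps :: real where "eps = 1 / (real s * 2 ^ (k + 2))"
  define m :: nat where "m = s * s * 2 ^ (k + 4)"
  define L where "L = blocker_size s t k"
  define B where "B = path_bound s t k"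
  define M where "M = real (spider_bound L B s k (s * k))"
  \<comment> \<open>The least values of \<open>d\<close> allowed by the remaining conditions.
    \<open>C\<close> dominates them all, so \<open>d \<ge> C\<close> suffices; it also exceeds
    \<open>2 * M\<close>, which gives the final contradiction, and the summand 1 ensures
    \<open>C \<ge> 1\<close>.\<close>
  define a1 where "a1 = 4 / eps * (real B * (real m + 2 ^ m * real t))"
  define a2 where "a2 = 2 / eps * real m"
  define a3 where "a3 = 4 * (real s * (real (s * Suc k * k) * real B))"
  define C where "C = 1 + 2 * M + a1 + a2 + a3"
  \<comment> \<open>Multiplying by \<open>s * k\<close> gives \<open>s - 1\<close>, so the powers of
    \<open>n\<close> cancel in the bound for \<open>d ^ (s * k)\<close>.\<close>
  define \<alpha> where "\<alpha> = (real s - 1) / (real s * real k)"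
  have eps: "eps > 0"
    using assms by (simp add: eps_def)
  have nonneg: "M \<ge> 0" "a1 \<ge> 0" "a2 \<ge> 0" "a3 \<ge> 0"
    using eps by (simp_all add: M_def a1_def a2_def a3_def)
  have bound: "real (card (edges G)) \<le> C * real n powr (1 + \<alpha>)"
    if n: "n \<ge> 1" and G: "simple_graph G" "card (verts G) = n"
      and free: "\<forall>H\<in>?\<H>. \<not> contains_graph G H" for n and G :: "nat graph"
  proof (rule ccontr)
    assume many: "\<not> real (card (edges G)) \<le> C * real n powr (1 + \<alpha>)"
    define d where "d = C * real n powr \<alpha>"
    have "\<alpha> \<ge> 0"
      using assms by (simp add: \<alpha>_def)
    then have "real n powr \<alpha> \<ge> 1"
      using n by (simp add: ge_one_powr_ge_zero)
    then have d: "d \<ge> C"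
      using nonneg mult_left_mono[of 1 "real n powr \<alpha>" C] by (simp add: d_def C_def)
    have "d * real n < real (card (edges G))"
      using many n by (simp add: d_def powr_add mult_ac)
    then obtain U where U: "U \<subseteq> verts G" "U \<noteq> {}"
      and deg: "\<And>x. x \<in> U \<Longrightarrow> d \<le> real (card {y \<in> U. {x, y} \<in> edges G})"
      using exists_min_degree_subgraph[OF G(1), of d] d nonneg G(2) by (auto simp: C_def)
    define E where "E x y \<longleftrightarrow> x \<in> U \<and> y \<in> U \<and> {x, y} \<in> edges G" for x y
    have finU: "finite U"
      using U G(1) finite_subset by (auto simp: simple_graph_def)
    interpret adjacency U E
    proof
      show "\<not> E x x" for x
        using G(1) by (force simp: E_def simple_graph_def)
    qed (use finU in \<open>auto simp: E_def insert_commute\<close>)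
    have "\<not> has_subdivision s t k"
      using subdivision_imp_contains[OF adjacency_axioms, of s t k G] free assms U(1)
      by (auto simp: E_def)
    then interpret subdivision_free U E s t k
      using assms by unfold_locales auto
    have ge: "a1 \<le> d" "a2 \<le> d" "a3 \<le> d" "1 \<le> d"
      using d nonneg by (simp_all add: C_def)
    interpret large_min_degree U E s t k m eps d
    proof
      show "d \<le> real (card {y. E x y})" if "x \<in> U" for x
        using deg[OF that] that by (simp add: E_def)
      show "real s \<le> real m * eps / 4"
        using assms by (simp add: m_def eps_def power_add field_simps)
      show "real s * 2 ^ k * eps \<le> 1 / 4"
        using assms by (simp add: eps_def power_add)
      show "real (path_bound s t k) * (real m + 2 ^ m * real t) \<le> eps / 4 * d"
        using ge(1) eps by (simp add: a1_def B_def field_simps)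
      show "real m \<le> eps / 2 * d"
        using ge(2) eps by (simp add: a2_def field_simps)
      show "real s * (real (s * Suc k * k) * real (path_bound s t k)) \<le> d / 4"
        using ge(3) by (simp add: a3_def B_def)
    qed (use eps ge assms in \<open>auto simp: m_def\<close>)
    have "d ^ (s * k) \<le> 2 * M * real (card U) ^ (s - 1)"
      using min_degree_power_le[OF U(2)] by (simp add: M_def L_def B_def)
    also have "\<dots> \<le> 2 * M * real n ^ (s - 1)"
    proof (intro mult_left_mono power_mono of_nat_mono)
      show "card U \<le> n"
        using U(1) G card_mono[of "verts G" U] by (simp add: simple_graph_def)
    qed (use nonneg in auto)
    also have "d ^ (s * k) = C ^ (s * k) * real n ^ (s - 1)"
    proof -
      have "(real n powr \<alpha>) ^ (s * k) = real n powr (\<alpha> * real (s * k))"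
        using n by (simp add: powr_powr powr_realpow[symmetric])
      also have "\<alpha> * real (s * k) = real (s - 1)"
        using assms by (simp add: \<alpha>_def of_nat_diff)
      also have "real n powr real (s - 1) = real n ^ (s - 1)"
        using n by (simp add: powr_realpow)
      finally show ?thesis
        by (simp add: d_def power_mult_distrib)
    qed
    finally have "C ^ (s * k) \<le> 2 * M"
      using n by simp
    moreover have "C ^ 1 \<le> C ^ (s * k)"
      using nonneg assms by (intro power_increasing) (auto simp: C_def Suc_le_eq)
    ultimately show False
      using nonneg by (simp add: C_def)
  qed
  have "extremal_number n ?\<H> \<le> C * real n powr (1 + \<alpha>)" if "n \<ge> 1" for n
  proof -
    let ?S = "{card (edges G) | G :: nat graph.
      simple_graph G \<and> card (verts G) = n \<and> (\<forall>H\<in>?\<H>. \<not> contains_graph G H)}"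
    \<comment> \<open>The maximum is attained: every member of the family has an edge, so the
      edgeless graph on \<open>n\<close> vertices qualifies.\<close>
    have "?S \<noteq> {}"
      using assms subdivided_bipartite_family_edges_nonempty[of _ k s t]
      by (intro extremal_set_nonempty) auto
    then have "extremal_number n ?\<H> \<in> ?S"
      unfolding extremal_number_def using finite_extremal_set by (rule Max_in[rotated])
    then show ?thesis
      using bound[OF that] by auto
  qed
  then have "eventually (\<lambda>n. norm (real (extremal_number n ?\<H>)) \<le> C * norm (real n powr (1 + \<alpha>))) at_top"
    by (intro eventually_at_top_linorderI[of 1]) auto
  then have "(\<lambda>n. real (extremal_number n ?\<H>)) \<in> O(\<lambda>n. real n powr (1 + \<alpha>))"
    by (rule bigoI)
  moreover have "1 + \<alpha> = 1 + 1 / real k - 1 / (real s * real k)"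
    using assms by (simp add: \<alpha>_def field_simps)
  ultimately show ?thesis
    by simp
qed

end
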